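(* Let $1\le p<2$, let $k\ge 1$ and let $\mathfrak{h}$ be any Lie algebra of $k\times k$ complex matrices containing $\mathfrak{t}(k,\mathbb{R})$. Let $\gamma_1,\gamma_2:[0,T]\to\mathbb{R}^d$ be paths of bounded $p$-variation whose signatures differ at the $n$-th level, i.e. $\pi_n[S(\gamma_1)]\neq\pi_n[S(\gamma_2)]$, and suppose $k\ge n+1$. Then there exists $M\in\mathcal{L}(\mathbb{R}^d;\mathfrak{h})$ such that $\mathscr{D}_{\gamma_1}(M)\neq\mathscr{D}_{\gamma_2}(M)$.
   Context: $\mathfrak{t}(k,\mathbb{R})$ is the space of real $k\times k$ antisymmetric matrices whose $(i,j)$-entry can be nonzero only if $|i-j|=1$. For a path $\gamma$ of bounded $p$-variation, $1\le p<2$, its signature is $S(\gamma)=(1,\gamma^{(1)},\gamma^{(2)},\dots)$ with $\pi_n[S(\gamma)]=\gamma^{(n)}=\int_{0<t_1<\cdots<t_n<T}d\gamma_{t_1}\otimes\cdots\otimes d\gamma_{t_n}\in(\mathbb{R}^d)^{\otimes n}$ (Young integrals). The (Cartan) development of $\gamma$ evaluated at a linear map $M:\mathbb{R}^d\to\mathfrak{h}$ is the matrix $\mathscr{D}_\gamma(M)=I_k+\sum_{n\ge1}\int_{0<t_1<\cdots<t_n<T}M(d\gamma_{t_1})\cdots M(d\gamma_{t_n})$ (matrix products, Young integrals). *)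

theory Defs
  imports "HOL-Analysis.Analysis"
begin

section \<open>Partitions of an interval\<close>

text \<open>A partition of [a,b] is a strictly increasing list a = t0 < t1 < ... < tm = b.\<close>
definition is_partition :: "real \<Rightarrow> real \<Rightarrow> real list \<Rightarrow> bool" where
  "is_partition a b ts \<longleftrightarrow> ts \<noteq> [] \<and> hd ts = a \<and> last ts = b \<and> sorted_wrt (<) ts"

text \<open>Consecutive pairs (t_i, t_(i+1)) of a partition.\<close>
definition intervals_of :: "real list \<Rightarrow> (real \<times> real) list" where
  "intervals_of ts = zip ts (tl ts)"

definition mesh :: "real list \<Rightarrow> real" where
  "mesh ts = Max (insert 0 (set (map (\<lambda>(s,t). t - s) (intervals_of ts))))"

section \<open>Bounded p-variation\<close>

definition bounded_p_variation ::
  "real \<Rightarrow> (real \<Rightarrow> 'a::real_normed_vector) \<Rightarrow> real \<Rightarrow> real \<Rightarrow> bool" where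
  "bounded_p_variation p \<gamma> a b \<longleftrightarrow>
     (\<exists>C. \<forall>ts. is_partition a b ts \<longrightarrow>
        (\<Sum>(s,t)\<leftarrow>intervals_of ts. norm (\<gamma> t - \<gamma> s) powr p) \<le> C)"

section \<open>Young (Riemann--Stieltjes) integrals\<close>

text \<open>The Young integral of f against g over [a,b], with respect to a bilinear product
  bil, defined as the limit of Riemann--Stieltjes sums (left-point evaluation) as the mesh
  of the partition tends to zero.\<close>
definition has_young_integral ::
  "('a \<Rightarrow> 'b::ab_group_add \<Rightarrow> 'c::real_normed_vector) \<Rightarrow> (real \<Rightarrow> 'a) \<Rightarrow> (real \<Rightarrow> 'b)
    \<Rightarrow> real \<Rightarrow> real \<Rightarrow> 'c \<Rightarrow> bool" where
  "has_young_integral bil f g a b I \<longleftrightarrow>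
     (\<forall>e>0. \<exists>\<delta>>0. \<forall>ts. is_partition a b ts \<and> mesh ts < \<delta> \<longrightarrow>
        dist (\<Sum>(s,t)\<leftarrow>intervals_of ts. bil (f s) (g t - g s)) I < e)"

definition young_integral ::
  "('a \<Rightarrow> 'b::ab_group_add \<Rightarrow> 'c::real_normed_vector) \<Rightarrow> (real \<Rightarrow> 'a) \<Rightarrow> (real \<Rightarrow> 'b)
    \<Rightarrow> real \<Rightarrow> real \<Rightarrow> 'c" where
  "young_integral bil f g a b = (THE I. has_young_integral bil f g a b I)"

section \<open>Signature\<close>

text \<open>Coordinates of the signature. The n-th level tensor is represented by its coordinates
  indexed by words of length n over the index type 'd of the coordinates of R^d.
  sig_rev \<gamma> (rev w) t is the coordinate
  \<integral>_{0<t1<...<tn<t} d\<gamma>^{w1}_{t1} ... d\<gamma>^{wn}_{tn}, defined recursively: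
  X^{w @ [i]}_t = \<integral>_0^t X^w_s d\<gamma>^i_s (Young integral).\<close>
fun sig_rev :: "(real \<Rightarrow> real^'d) \<Rightarrow> 'd list \<Rightarrow> real \<Rightarrow> real" where
  "sig_rev \<gamma> [] t = 1"
| "sig_rev \<gamma> (i # v) t = young_integral (*) (sig_rev \<gamma> v) (\<lambda>s. \<gamma> s $ i) 0 t"

definition sig_coord :: "(real \<Rightarrow> real^'d) \<Rightarrow> real \<Rightarrow> 'd list \<Rightarrow> real" where
  "sig_coord \<gamma> T w = sig_rev \<gamma> (rev w) T"

text \<open>pi_n[S(\<gamma>)] as an element of (R^d)^{\<otimes>n}, given by its coordinates on words of length n.\<close>
definition sig_level :: "(real \<Rightarrow> real^'d) \<Rightarrow> real \<Rightarrow> nat \<Rightarrow> ('d list \<Rightarrow> real)" where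
  "sig_level \<gamma> T n = (\<lambda>w. if length w = n then sig_coord \<gamma> T w else 0)"

section \<open>Cartan development\<close>

text \<open>n-th term \<integral>_{0<t1<...<tn<t} M(d\<gamma>_{t1}) ... M(d\<gamma>_{tn}), defined recursively
  by Y_0(t) = I and Y_{n+1}(t) = \<integral>_0^t Y_n(s) M(d\<gamma>_s) (Young integral, matrix product).\<close>
fun dev_term :: "(real^'d \<Rightarrow> complex^'k^'k) \<Rightarrow> (real \<Rightarrow> real^'d) \<Rightarrow> nat \<Rightarrow> real \<Rightarrow> complex^'k^'k" where
  "dev_term M \<gamma> 0 t = mat 1"
| "dev_term M \<gamma> (Suc n) t = young_integral (**) (dev_term M \<gamma> n) (\<lambda>s. M (\<gamma> s)) 0 t"

definition development :: "(real \<Rightarrow> real^'d) \<Rightarrow> real \<Rightarrow> (real^'d \<Rightarrow> complex^'k^'k) \<Rightarrow> complex^'k^'k" where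
  "development \<gamma> T M = (\<Sum>n. dev_term M \<gamma> n T)"

section \<open>Matrix Lie algebras\<close>

text \<open>Position of an index in the (finite, linearly ordered) index type, 0-based.\<close>
definition idx_pos :: "'k::{finite,linorder} \<Rightarrow> nat" where
  "idx_pos i = card {j. j < i}"

text \<open>t(k,R): real antisymmetric k x k matrices, nonzero only on the first off-diagonals,
  viewed as complex matrices.\<close>
definition tk_real :: "((complex, 'k::{finite,linorder}) vec, 'k) vec set" where
  "tk_real = {A.
      (\<forall>i j. Im (A $ i $ j) = 0 \<and> A $ i $ j = - (A $ j $ i) \<and>
             (A $ i $ j \<noteq> 0 \<longrightarrow> idx_pos i = idx_pos j + 1 \<or> idx_pos j = idx_pos i + 1))}"

text \<open>A (real) Lie algebra of complex matrices: a real subspace closed under commutators.\<close>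
definition matrix_lie_algebra :: "(complex^'k^'k) set \<Rightarrow> bool" where
  "matrix_lie_algebra h \<longleftrightarrow> subspace h \<and> (\<forall>A\<in>h. \<forall>B\<in>h. A ** B - B ** A \<in> h)"

end

theory Submission
  imports Defs
begin

text \<open>Fix a word \<open>w\<close> of length \<open>n\<close> at which the two signatures differ, and let \<open>M\<^sub>w\<close> be the linear
  map sending the \<open>a\<close>-th basis vector to the antisymmetric tridiagonal matrix whose \<open>(l, l+1)\<close>
  entry is \<open>1\<close> iff \<open>w ! l = a\<close> (for \<open>l < n\<close>). Then \<open>M\<^sub>w \<in> t(k,\<real>)\<close>, and the \<open>(0, n)\<close> entry of
  \<open>M\<^sub>w(e\<^sub>a\<^sub>1) \<cdots> M\<^sub>w(e\<^sub>a\<^sub>m)\<close> vanishes for \<open>m < n\<close> and, for \<open>m = n\<close>, is \<open>1\<close> exactly when \<open>a = w\<close>.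
  Expanding the development as a sum over words of signature coordinates, the \<open>(0, n)\<close> entry of
  the development of \<open>\<gamma>\<close> at \<open>c M\<^sub>w\<close> is therefore a power series in \<open>c\<close> whose coefficients
  vanish below order \<open>n\<close> and equal the \<open>w\<close>-coordinate of the signature at order \<open>n\<close>. If the
  developments of \<open>\<gamma>\<^sub>1\<close> and \<open>\<gamma>\<^sub>2\<close> agreed at every \<open>c M\<^sub>w\<close>, the two power series would agree near
  \<open>0\<close>, and so would their coefficients of order \<open>n\<close>.

  The analytic input is Young's theory for \<open>p < 2\<close>: the Young--Loeve estimate, obtained by
  successively deleting partition points, shows that the iterated integrals defining the
  signature exist, and yields the geometric bound \<open>\<bar>S(\<gamma>)\<^sup>v\<bar> \<le> R\<^bsup>|v|\<^esup>\<close> that makes the series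
  converge for small \<open>c\<close>.\<close>

section \<open>Partitions\<close>

lemma intervals_of_simps [simp]:
  "intervals_of [] = []" "intervals_of [x] = []"
  "intervals_of (x # y # zs) = (x, y) # intervals_of (y # zs)"
  by (simp_all add: intervals_of_def)

lemma intervals_of_Cons: "ys \<noteq> [] \<Longrightarrow> intervals_of (x # ys) = (x, hd ys) # intervals_of ys"
  by (cases ys) auto

lemma intervals_of_append:
  "xs \<noteq> [] \<Longrightarrow> ys \<noteq> [] \<Longrightarrow> last xs = hd ys \<Longrightarrow>
   intervals_of (xs @ tl ys) = intervals_of xs @ intervals_of ys"
proof (induction xs)
  case (Cons x xs)
  show ?case
  proof (cases "xs = []")
    case True
    then show ?thesis using Cons.prems by (cases ys) (auto simp: intervals_of_Cons)
  next
    case False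
    then show ?thesis using Cons by (simp add: intervals_of_Cons)
  qed
qed simp

lemma intervals_of_middle:
  "intervals_of (xs @ [u, v, w] @ ys) = intervals_of (xs @ [u]) @ [(u,v),(v,w)] @ intervals_of (w # ys)"
  "intervals_of (xs @ [u, w] @ ys) = intervals_of (xs @ [u]) @ [(u,w)] @ intervals_of (w # ys)"
  by (induction xs rule: induct_list012) (auto simp: intervals_of_Cons)

lemma intervals_of_memD: "(s,t) \<in> set (intervals_of xs) \<Longrightarrow> s \<in> set xs \<and> t \<in> set xs"
  by (induction xs rule: induct_list012) auto

lemma intervals_of_less: "sorted_wrt (<) xs \<Longrightarrow> (s,t) \<in> set (intervals_of xs) \<Longrightarrow> s < t"
  by (induction xs rule: induct_list012) auto

lemma strict_sorted_hd_le: "sorted_wrt (<) (xs::real list) \<Longrightarrow> x \<in> set xs \<Longrightarrow> hd xs \<le> x"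
  by (cases xs) auto

lemma strict_sorted_le_last: "sorted_wrt (<) (xs::real list) \<Longrightarrow> x \<in> set xs \<Longrightarrow> x \<le> last xs"
proof (induction xs)
  case (Cons y ys)
  then show ?case by (cases "ys = []") (auto intro: less_imp_le)
qed simp

lemma is_partitionD: "is_partition a b ts \<Longrightarrow> ts \<noteq> [] \<and> hd ts = a \<and> last ts = b"
  by (simp add: is_partition_def)

lemma is_partition_memD: "is_partition a b ts \<Longrightarrow> x \<in> set ts \<Longrightarrow> a \<le> x \<and> x \<le> b"
  unfolding is_partition_def using strict_sorted_hd_le strict_sorted_le_last by blast

lemma is_partition_le: "is_partition a b ts \<Longrightarrow> a \<le> b"
  using is_partition_memD[of a b ts a] by (auto simp: is_partition_def)

lemma is_partition_append:
  assumes P: "is_partition a c xs" and Q: "is_partition c b ys"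
  shows "is_partition a b (xs @ tl ys)"
proof -
  obtain zs where ys: "ys = c # zs" using Q by (cases ys) (auto simp: is_partition_def)
  have "\<forall>x\<in>set xs. x \<le> c" using P is_partition_memD by blast
  moreover have "\<forall>y\<in>set zs. c < y" "sorted_wrt (<) zs" using Q ys by (auto simp: is_partition_def)
  ultimately have "sorted_wrt (<) (xs @ zs)" using P by (force simp: is_partition_def sorted_wrt_append)
  moreover have "last (xs @ zs) = b" using P Q ys by (cases "zs = []") (auto simp: is_partition_def)
  ultimately show ?thesis using P ys by (auto simp: is_partition_def)
qed

definition trivial_partition :: "real \<Rightarrow> real \<Rightarrow> real list" where
  "trivial_partition a b = (if a < b then [a, b] else [a])"

lemma is_partition_trivial_partition: "a \<le> b \<Longrightarrow> is_partition a b (trivial_partition a b)"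
  by (auto simp: trivial_partition_def is_partition_def)

lemma is_partition_degenerate: "is_partition a a ts \<longleftrightarrow> ts = [a]"
proof
  assume P: "is_partition a a ts"
  then have "set ts \<subseteq> {a}" "sorted_wrt (<) ts" "ts \<noteq> []"
    using is_partition_memD[OF P] by (fastforce simp: is_partition_def)+
  then show "ts = [a]"
    by (cases ts; cases "tl ts") auto
qed (auto simp: is_partition_def)

lemma mesh_less_iff: "0 < d \<Longrightarrow> mesh ts < d \<longleftrightarrow> (\<forall>(s,t)\<in>set (intervals_of ts). t - s < d)"
  by (auto simp: mesh_def)

lemma mesh_le: "(\<forall>(s,t)\<in>set (intervals_of ts). t - s \<le> d) \<Longrightarrow> 0 \<le> d \<Longrightarrow> mesh ts \<le> d"
  by (auto simp: mesh_def)

lemma mesh_append_less: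
  assumes "is_partition a c P1" "is_partition c b P2" "mesh P1 < d" "mesh P2 < d" "0 < d"
  shows "mesh (P1 @ tl P2) < d"
proof -
  have "intervals_of (P1 @ tl P2) = intervals_of P1 @ intervals_of P2"
    using is_partitionD[OF assms(1)] is_partitionD[OF assms(2)] by (intro intervals_of_append) auto
  then show ?thesis using assms(3-5) by (auto simp: mesh_less_iff)
qed


section \<open>Controls and the Young--Loeve estimate\<close>

lemma sum_list_mult_left_split: "(\<Sum>(s,t)\<leftarrow>xs. c * f s t) = (c::'a::semiring_0) * (\<Sum>(s,t)\<leftarrow>xs. f s t)"
  by (induction xs) (auto simp: algebra_simps)

definition control_on :: "(real \<Rightarrow> real \<Rightarrow> real) \<Rightarrow> real \<Rightarrow> real \<Rightarrow> bool" where
  "control_on \<omega> a b \<longleftrightarrow>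
     (\<forall>s u t. a \<le> s \<and> s \<le> u \<and> u \<le> t \<and> t \<le> b \<longrightarrow> \<omega> s u + \<omega> u t \<le> \<omega> s t) \<and>
     (\<forall>s t. a \<le> s \<and> s \<le> t \<and> t \<le> b \<longrightarrow> 0 \<le> \<omega> s t)"

lemma control_onD:
  assumes "control_on \<omega> a b"
  shows control_on_superadditive:
      "\<And>s u t. a \<le> s \<Longrightarrow> s \<le> u \<Longrightarrow> u \<le> t \<Longrightarrow> t \<le> b \<Longrightarrow> \<omega> s u + \<omega> u t \<le> \<omega> s t"
    and control_on_nonneg: "\<And>s t. a \<le> s \<Longrightarrow> s \<le> t \<Longrightarrow> t \<le> b \<Longrightarrow> 0 \<le> \<omega> s t"
  using assms by (auto simp: control_on_def)

lemma control_on_mono: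
  assumes "control_on \<omega> a b" "a \<le> s" "s \<le> s'" "s' \<le> t'" "t' \<le> t" "t \<le> b"
  shows "\<omega> s' t' \<le> \<omega> s t"
proof -
  have "\<omega> s s' + \<omega> s' t \<le> \<omega> s t" "\<omega> s' t' + \<omega> t' t \<le> \<omega> s' t"
    using control_on_superadditive[OF assms(1)] assms by simp_all
  moreover have "0 \<le> \<omega> s s'" "0 \<le> \<omega> t' t" using control_on_nonneg[OF assms(1)] assms by auto
  ultimately show ?thesis by linarith
qed

lemma control_on_subinterval: "control_on \<omega> a b \<Longrightarrow> a \<le> a' \<Longrightarrow> b' \<le> b \<Longrightarrow> control_on \<omega> a' b'"
  unfolding control_on_def by (meson order_trans)

lemma control_on_sum_le:
  assumes \<omega>: "control_on \<omega> a b"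
  shows "is_partition s t L \<Longrightarrow> a \<le> s \<Longrightarrow> t \<le> b \<Longrightarrow> (\<Sum>(u,v)\<leftarrow>intervals_of L. \<omega> u v) \<le> \<omega> s t"
proof (induction L arbitrary: s)
  case (Cons x L)
  show ?case
  proof (cases "L = []")
    case True
    then show ?thesis using Cons.prems control_on_nonneg[OF \<omega>] by (auto simp: is_partition_def)
  next
    case False
    have x: "x = s" using Cons.prems by (simp add: is_partition_def)
    have P: "is_partition (hd L) t L" and s: "s < hd L"
      using Cons.prems False x by (auto simp: is_partition_def)
    have "(\<Sum>(u,v)\<leftarrow>intervals_of L. \<omega> u v) \<le> \<omega> (hd L) t"
      using Cons.IH[OF P] Cons.prems s by simp
    moreover have "\<omega> s (hd L) + \<omega> (hd L) t \<le> \<omega> s t"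
      using control_on_superadditive[OF \<omega>] Cons.prems s is_partition_le[OF P] by simp
    ultimately show ?thesis using False x by (simp add: intervals_of_Cons)
  qed
qed (simp add: is_partition_def)

lemma control_on_sum_powr_le:
  assumes \<omega>: "control_on \<omega> 0 T" and \<theta>: "1 \<le> \<theta>"
    and P: "is_partition a b P" and ab: "0 \<le> a" "b \<le> T"
  shows "(\<Sum>(s,t)\<leftarrow>intervals_of P. \<omega> s t powr \<theta>) \<le> \<omega> a b powr \<theta>"
proof -
  have powr_split: "x powr \<theta> = x powr (\<theta> - 1) * x" if "0 \<le> x" for x :: real
    using that powr_add[of x "\<theta> - 1" 1] by (cases "x = 0") (use \<theta> in auto)
  have "(\<Sum>(s,t)\<leftarrow>intervals_of P. \<omega> s t powr \<theta>) \<le> (\<Sum>(s,t)\<leftarrow>intervals_of P. \<omega> a b powr (\<theta> - 1) * \<omega> s t)"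
  proof (rule sum_list_mono, clarify)
    fix s t assume st: "(s, t) \<in> set (intervals_of P)"
    then have "a \<le> s" "s \<le> t" "t \<le> b"
      using intervals_of_memD[OF st] intervals_of_less[OF _ st] is_partition_memD[OF P] P
      by (auto simp: is_partition_def)
    then have "0 \<le> \<omega> s t" "\<omega> s t \<le> \<omega> a b"
      using control_on_nonneg[OF \<omega>] control_on_mono[OF \<omega>] ab by auto
    then show "\<omega> s t powr \<theta> \<le> \<omega> a b powr (\<theta> - 1) * \<omega> s t"
      using \<theta> by (simp add: powr_split mult_right_mono powr_mono2)
  qed
  also have "\<dots> = \<omega> a b powr (\<theta> - 1) * (\<Sum>(s,t)\<leftarrow>intervals_of P. \<omega> s t)"
    by (rule sum_list_mult_left_split)
  also have "\<dots> \<le> \<omega> a b powr (\<theta> - 1) * \<omega> a b"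
    using control_on_sum_le[OF \<omega> P] ab by (intro mult_left_mono) auto
  also have "\<dots> = \<omega> a b powr \<theta>"
    using powr_split control_on_nonneg[OF \<omega>] ab is_partition_le[OF P] by simp
  finally show ?thesis .
qed

definition rsum :: "(real \<Rightarrow> real) \<Rightarrow> (real \<Rightarrow> real) \<Rightarrow> real list \<Rightarrow> real" where
  "rsum X g ts = (\<Sum>(s,t)\<leftarrow>intervals_of ts. X s * (g t - g s))"

lemma rsum_append:
  "xs \<noteq> [] \<Longrightarrow> ys \<noteq> [] \<Longrightarrow> last xs = hd ys \<Longrightarrow> rsum X g (xs @ tl ys) = rsum X g xs + rsum X g ys"
  by (simp add: rsum_def intervals_of_append)

lemma rsum_remove_point:
  "rsum X g (xs @ [u, v, w] @ ys) - rsum X g (xs @ [u, w] @ ys) = (X v - X u) * (g w - g v)"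
  unfolding rsum_def intervals_of_middle by (simp add: algebra_simps)

lemma rsum_singleton [simp]: "rsum X g [x] = 0"
  by (simp add: rsum_def)

lemma rsum_two [simp]: "rsum X g [x, y] = X x * (g y - g x)"
  by (simp add: rsum_def)

text \<open>Young's pigeonhole step: by superadditivity the \<open>length L - 2\<close> windows \<open>[t\<^sub>i, t\<^sub>i\<^sub>+\<^sub>2]\<close>
  cover \<open>[hd L, last L]\<close> at most twice, so one of them carries at most the fraction
  \<open>2 / (length L - 2)\<close> of the control.\<close>
lemma exists_removable_point:
  assumes \<omega>: "control_on \<omega> a b"
  shows "sorted_wrt (<) L \<Longrightarrow> set L \<subseteq> {a..b} \<Longrightarrow> 3 \<le> length L \<Longrightarrow>
    \<exists>xs u v w ys. L = xs @ [u,v,w] @ ys \<and> (real (length L) - 2) * \<omega> u w \<le> 2 * \<omega> (hd L) (last L)"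
proof (induction "length L" arbitrary: L rule: less_induct)
  case less
  obtain t0 t1 t2 L' where L: "L = t0 # t1 # t2 # L'" using less.prems(3)
    by (metis Suc_le_length_iff numeral_3_eq_3)
  have in_ab: "\<And>x. x \<in> set L \<Longrightarrow> a \<le> x \<and> x \<le> b" using less.prems(2) by auto
  have t02: "t0 < t2" "t2 \<le> last L"
    using less.prems(1) L strict_sorted_le_last[OF less.prems(1), of t2] by auto
  have ab: "a \<le> t0" "last L \<le> b" using in_ab L last_in_set[of L] by auto
  have nn: "0 \<le> \<omega> t0 t2" using control_on_nonneg[OF \<omega>] ab t02 by auto
  show ?case
  proof (cases "length L \<le> 4 \<or> (real (length L) - 2) * \<omega> t0 t2 \<le> 2 * \<omega> t0 (last L)")
    case True
    have "(real (length L) - 2) * \<omega> t0 t2 \<le> 2 * \<omega> t0 (last L)"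
    proof (cases "length L \<le> 4")
      case True
      have "(real (length L) - 2) * \<omega> t0 t2 \<le> 2 * \<omega> t0 t2"
        using True nn by (intro mult_right_mono) auto
      also have "\<dots> \<le> 2 * \<omega> t0 (last L)"
        using control_on_mono[OF \<omega>, of t0 t0 t2 "last L"] ab t02 by simp
      finally show ?thesis .
    qed (use True in auto)
    then show ?thesis using L by (intro exI[of _ "[]"]) auto
  next
    case False
    define L2 where "L2 = t2 # L'"
    define n where "n = real (length L)"
    have n5: "5 \<le> n" and len: "real (length L2) = n - 2"
      using L False by (auto simp: L2_def n_def)
    have "\<exists>xs u v w ys. L2 = xs @ [u,v,w] @ ys \<and>
        (real (length L2) - 2) * \<omega> u w \<le> 2 * \<omega> (hd L2) (last L2)"
      by (rule less.hyps) (use L less.prems False in \<open>auto simp: L2_def\<close>)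
    moreover have "hd L2 = t2" "last L2 = last L" "real (length L2) - 2 = n - 4"
      using L len by (simp_all add: L2_def)
    ultimately obtain xs u v w ys where dec: "L2 = xs @ [u,v,w] @ ys"
      and ineq: "(n - 4) * \<omega> u w \<le> 2 * \<omega> t2 (last L)"
      by auto
    have "u \<in> set L" "w \<in> set L" "u \<le> w"
      using dec L less.prems(1) by (auto simp: L2_def sorted_wrt_append)
    then have nuw: "0 \<le> \<omega> u w" using control_on_nonneg[OF \<omega>] in_ab by auto
    have sup: "\<omega> t0 t2 + \<omega> t2 (last L) \<le> \<omega> t0 (last L)"
      using control_on_superadditive[OF \<omega>] ab t02 by auto
    have big: "2 * \<omega> t0 (last L) < (n - 2) * \<omega> t0 t2" using False by (simp add: n_def)
    have "(n - 2) * \<omega> u w \<le> 2 * \<omega> t0 (last L)"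
    proof (rule ccontr)
      assume "\<not> ?thesis"
      then have "(n - 4) * (2 * \<omega> t0 (last L)) < (n - 4) * ((n - 2) * \<omega> u w)"
        using n5 by (intro mult_strict_left_mono) auto
      also have "\<dots> \<le> (n - 2) * (2 * \<omega> t2 (last L))"
        using mult_left_mono[OF ineq, of "n - 2"] n5 by (simp add: algebra_simps)
      also have "\<dots> \<le> (n - 2) * (2 * (\<omega> t0 (last L) - \<omega> t0 t2))"
        using sup n5 by (intro mult_left_mono) auto
      finally show False using big by (simp add: algebra_simps)
    qed
    moreover have "L = (t0 # t1 # xs) @ [u,v,w] @ ys" using dec L by (simp add: L2_def)
    ultimately show ?thesis using L unfolding n_def by (metis list.sel(1))
  qed
qed

definition young_const :: "real \<Rightarrow> real" where
  "young_const \<theta> = (\<Sum>j. (2 / real (Suc j)) powr \<theta>)"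

lemma summable_young_const: "1 < \<theta> \<Longrightarrow> summable (\<lambda>j. (2 / real (Suc j)) powr \<theta>)"
proof -
  assume \<theta>: "1 < \<theta>"
  have "summable (\<lambda>n. real n powr (-\<theta>))" using \<theta> by (subst summable_real_powr_iff) auto
  then have "summable (\<lambda>n. real (Suc n) powr (-\<theta>))" by (subst summable_Suc_iff)
  then have "summable (\<lambda>n. 2 powr \<theta> * real (Suc n) powr (-\<theta>))" by (rule summable_mult)
  moreover have "(2 / real (Suc n)) powr \<theta> = 2 powr \<theta> * real (Suc n) powr (-\<theta>)" for n
    by (subst powr_divide) (auto simp: powr_minus divide_inverse)
  ultimately show ?thesis by simp
qed

lemma sum_le_young_const: "1 < \<theta> \<Longrightarrow> (\<Sum>j\<in>{1..<m}. (2 / real j) powr \<theta>) \<le> young_const \<theta>"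
proof -
  assume \<theta>: "1 < \<theta>"
  have "(\<Sum>j\<in>{1..<m}. (2 / real j) powr \<theta>) = (\<Sum>j<m - 1. (2 / real (Suc j)) powr \<theta>)"
    using sum.shift_bounds_Suc_ivl[of "\<lambda>j. (2 / real j) powr \<theta>" 0 "m - 1"]
    by (cases m) (simp_all add: atLeast0LessThan)
  also have "\<dots> \<le> young_const \<theta>" unfolding young_const_def
    by (rule sum_le_suminf[OF summable_young_const[OF \<theta>]]) auto
  finally show ?thesis .
qed

lemma young_const_nonneg: "1 < \<theta> \<Longrightarrow> 0 \<le> young_const \<theta>"
  using sum_le_young_const[of \<theta> 0] by simp

lemma young_loeve_finite_sum:
  assumes \<omega>: "control_on \<omega> a b" and C: "0 \<le> C" and \<theta>: "0 \<le> \<theta>"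
    and H: "\<And>u v w. a \<le> u \<Longrightarrow> u \<le> v \<Longrightarrow> v \<le> w \<Longrightarrow> w \<le> b \<Longrightarrow>
              \<bar>(X v - X u) * (g w - g v)\<bar> \<le> C * \<omega> u w powr \<theta>"
  shows "is_partition a b L \<Longrightarrow> \<bar>rsum X g L - X a * (g b - g a)\<bar> \<le>
           C * \<omega> a b powr \<theta> * (\<Sum>j\<in>{1..<length L - 1}. (2 / real j) powr \<theta>)"
proof (induction "length L" arbitrary: L rule: less_induct)
  case less
  have P: "sorted_wrt (<) L" "L \<noteq> []" "hd L = a" "last L = b"
    using less.prems by (auto simp: is_partition_def)
  have nnR: "0 \<le> C * \<omega> a b powr \<theta> * (\<Sum>j\<in>{1..<m}. (2 / real j) powr \<theta>)" for m
    using C by (intro mult_nonneg_nonneg sum_nonneg) auto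
  show ?case
  proof (cases "length L \<le> 2")
    case True
    then consider "L = [a]" "b = a" | "L = [a, b]" using P
      by (cases L; cases "tl L") auto
    then show ?thesis using nnR by cases simp_all
  next
    case False
    have inab: "set L \<subseteq> {a..b}" using is_partition_memD[OF less.prems] by auto
    obtain xs u v w ys where dec: "L = xs @ [u,v,w] @ ys"
      and ineq: "(real (length L) - 2) * \<omega> u w \<le> 2 * \<omega> (hd L) (last L)"
      using exists_removable_point[OF \<omega> P(1) inab] False by auto
    define L' where "L' = xs @ [u,w] @ ys"
    have "sorted_wrt (<) L'" "hd L' = a" "last L' = b"
      using P unfolding dec L'_def
      by (auto simp: sorted_wrt_append hd_append split: if_splits)
    then have L': "is_partition a b L'" by (auto simp: is_partition_def L'_def)
    have IH: "\<bar>rsum X g L' - X a * (g b - g a)\<bar> \<le>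
        C * \<omega> a b powr \<theta> * (\<Sum>j\<in>{1..<length L' - 1}. (2 / real j) powr \<theta>)"
      using less.hyps[OF _ L'] False by (simp add: dec L'_def)
    have uvw: "a \<le> u" "u \<le> v" "v \<le> w" "w \<le> b"
      using inab P(1) unfolding dec by (auto simp: sorted_wrt_append)
    define n where "n = real (length L)"
    have n3: "3 \<le> n" using False by (simp add: n_def)
    have "\<omega> u w \<le> (2 / (n - 2)) * \<omega> a b"
      using ineq P n3 by (simp add: n_def field_simps)
    then have "\<omega> u w powr \<theta> \<le> (2 / (n - 2)) powr \<theta> * \<omega> a b powr \<theta>"
      using \<theta> control_on_nonneg[OF \<omega>] uvw by (metis order.trans powr_mono2 powr_mult)
    then have removed: "\<bar>rsum X g L - rsum X g L'\<bar> \<le> C * \<omega> a b powr \<theta> * (2 / (n - 2)) powr \<theta>"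
      using rsum_remove_point[of X g xs u v w ys] H[OF uvw] C unfolding dec L'_def
      by (smt (verit) mult.commute mult.left_commute mult_left_mono)
    have "(\<Sum>j\<in>{1..<length L - 1}. (2 / real j) powr \<theta>) =
       (\<Sum>j\<in>{1..<length L' - 1}. (2 / real j) powr \<theta>) + (2 / (n - 2)) powr \<theta>"
    proof -
      define k where "k = length L' - 1"
      have "length L - 1 = Suc k" "1 \<le> k" "real k = n - 2"
        using False by (auto simp: dec L'_def n_def k_def)
      then show ?thesis unfolding k_def[symmetric] by (simp add: sum.atLeastLessThan_Suc)
    qed
    then show ?thesis using IH removed by (simp add: algebra_simps)
  qed
qed

lemma young_loeve:
  assumes "control_on \<omega> a b" "0 \<le> C" and \<theta>: "1 < \<theta>"
    and "\<And>u v w. a \<le> u \<Longrightarrow> u \<le> v \<Longrightarrow> v \<le> w \<Longrightarrow> w \<le> b \<Longrightarrow>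
            \<bar>(X v - X u) * (g w - g v)\<bar> \<le> C * \<omega> u w powr \<theta>"
    and "is_partition a b L"
  shows "\<bar>rsum X g L - X a * (g b - g a)\<bar> \<le> C * young_const \<theta> * \<omega> a b powr \<theta>"
proof -
  have "\<bar>rsum X g L - X a * (g b - g a)\<bar> \<le>
      C * \<omega> a b powr \<theta> * (\<Sum>j\<in>{1..<length L - 1}. (2 / real j) powr \<theta>)"
    using young_loeve_finite_sum assms by simp
  also have "\<dots> \<le> C * \<omega> a b powr \<theta> * young_const \<theta>"
    using sum_le_young_const[OF \<theta>] assms(2) by (intro mult_left_mono) auto
  finally show ?thesis by (simp add: algebra_simps)
qed

section \<open>Existence of Young integrals\<close>

definition uniform_partition :: "real \<Rightarrow> real \<Rightarrow> nat \<Rightarrow> real list" where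
  "uniform_partition a b N =
     (if a < b then map (\<lambda>k. a + (b - a) * real k / real N) [0..<Suc N] else [a])"

lemma intervals_of_map_upt:
  "intervals_of (map f [0..<Suc N]) = map (\<lambda>k. (f k, f (Suc k))) [0..<N]"
proof (induction N)
  case (Suc N)
  have "map f [0..<Suc (Suc N)] = map f [0..<Suc N] @ tl [f N, f (Suc N)]" by simp
  then have "intervals_of (map f [0..<Suc (Suc N)]) =
      intervals_of (map f [0..<Suc N]) @ intervals_of [f N, f (Suc N)]"
    using intervals_of_append[of "map f [0..<Suc N]" "[f N, f (Suc N)]"] by (simp add: last_map)
  then show ?case using Suc by simp
qed simp

lemma is_partition_uniform_partition:
  assumes "a \<le> b" "1 \<le> N"
  shows "is_partition a b (uniform_partition a b N)"
proof (cases "a < b")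
  case True
  have "sorted_wrt (<) (map (\<lambda>k. a + (b - a) * real k / real N) [0..<Suc N])"
    unfolding sorted_wrt_map using True assms
    by (intro sorted_wrt_mono_rel[OF _ sorted_wrt_upt]) (auto simp: divide_strict_right_mono)
  moreover have "last (map (\<lambda>k. a + (b - a) * real k / real N) [0..<Suc N]) = b"
    using assms by (simp add: last_map)
  moreover have "[0..<Suc N] = 0 # [1..<Suc N]" by (simp add: upt_conv_Cons)
  ultimately show ?thesis using True by (simp add: uniform_partition_def is_partition_def del: upt_Suc)
qed (use assms in \<open>simp add: uniform_partition_def is_partition_def\<close>)

lemma mesh_uniform_partition_le:
  assumes "a \<le> b" "1 \<le> N"
  shows "mesh (uniform_partition a b N) \<le> (b - a) / real N"
proof (cases "a < b")
  case True
  define f where "f k = a + (b - a) * real k / real N" for k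
  have "intervals_of (uniform_partition a b N) = map (\<lambda>k. (f k, f (Suc k))) [0..<N]"
    using True unfolding uniform_partition_def f_def[abs_def]
    by (simp add: intervals_of_map_upt del: upt_Suc)
  moreover have "f (Suc k) - f k \<le> (b - a) / real N" for k
    using assms by (simp add: f_def field_simps)
  ultimately show ?thesis using assms by (intro mesh_le) auto
qed (use assms in \<open>simp add: uniform_partition_def mesh_def\<close>)

definition fine_partitions :: "real \<Rightarrow> real \<Rightarrow> real list filter" where
  "fine_partitions a b = (INF d\<in>{0<..}. principal {ts. is_partition a b ts \<and> mesh ts < d})"

lemma eventually_fine_partitions:
  "eventually P (fine_partitions a b) \<longleftrightarrow> (\<exists>d>0. \<forall>ts. is_partition a b ts \<and> mesh ts < d \<longrightarrow> P ts)"
proof -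
  have "eventually P (fine_partitions a b) \<longleftrightarrow>
      (\<exists>d\<in>{0<..}. eventually P (principal {ts. is_partition a b ts \<and> mesh ts < d}))"
    unfolding fine_partitions_def
  proof (rule eventually_INF_base)
    fix x y :: real assume "x \<in> {0<..}" "y \<in> {0<..}"
    then show "\<exists>z\<in>{0<..}. principal {ts. is_partition a b ts \<and> mesh ts < z} \<le>
       inf (principal {ts. is_partition a b ts \<and> mesh ts < x}) (principal {ts. is_partition a b ts \<and> mesh ts < y})"
      by (intro bexI[of _ "min x y"]) auto
  qed auto
  then show ?thesis by (auto simp: eventually_principal)
qed

lemma eventually_is_partition_fine_partitions: "eventually (is_partition a b) (fine_partitions a b)"
  unfolding eventually_fine_partitions by (intro exI[of _ 1]) auto

lemma filterlim_uniform_partition: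
  assumes ab: "a \<le> b"
  shows "filterlim (\<lambda>N. uniform_partition a b (Suc N)) (fine_partitions a b) sequentially"
  unfolding filterlim_iff eventually_fine_partitions
proof clarify
  fix P and d :: real assume d: "0 < d" and P: "\<forall>ts. is_partition a b ts \<and> mesh ts < d \<longrightarrow> P ts"
  obtain N0 where N0: "inverse (real (Suc N0)) < d / (b - a + 1)"
    using reals_Archimedean[of "d / (b - a + 1)"] ab d by auto
  have fine: "mesh (uniform_partition a b (Suc N)) < d" if "N0 \<le> N" for N
  proof -
    have "mesh (uniform_partition a b (Suc N)) \<le> (b - a) / real (Suc N)"
      using mesh_uniform_partition_le[OF ab, of "Suc N"] by simp
    also have "\<dots> \<le> (b - a + 1) * inverse (real (Suc N))"
      unfolding divide_inverse by (rule mult_right_mono) auto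
    also have "\<dots> \<le> (b - a + 1) * inverse (real (Suc N0))"
      using that ab by (intro mult_left_mono le_imp_inverse_le) auto
    also have "\<dots> < d"
      using N0 ab by (simp add: field_simps)
    finally show ?thesis .
  qed
  show "eventually (\<lambda>N. P (uniform_partition a b (Suc N))) sequentially"
    unfolding eventually_sequentially
  proof (intro exI[of _ N0] allI impI)
    fix N assume "N0 \<le> N"
    then show "P (uniform_partition a b (Suc N))"
      using P fine is_partition_uniform_partition[OF ab, of "Suc N"] by simp
  qed
qed

lemma fine_partitions_neq_bot: "a \<le> b \<Longrightarrow> fine_partitions a b \<noteq> bot"
  using filterlim_uniform_partition[of a b, unfolded filterlim_iff, rule_format, of "\<lambda>_. False"]
  by auto

lemma has_young_integral_iff_tendsto:
  "has_young_integral bil f g a b I \<longleftrightarrow>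
     ((\<lambda>ts. \<Sum>(s,t)\<leftarrow>intervals_of ts. bil (f s) (g t - g s)) \<longlongrightarrow> I) (fine_partitions a b)"
  unfolding has_young_integral_def tendsto_iff eventually_fine_partitions ..

lemma has_young_integral_unique:
  "a \<le> b \<Longrightarrow> has_young_integral bil f g a b I \<Longrightarrow> has_young_integral bil f g a b J \<Longrightarrow> I = J"
  unfolding has_young_integral_iff_tendsto using tendsto_unique fine_partitions_neq_bot by blast

lemma young_integral_eq:
  "a \<le> b \<Longrightarrow> has_young_integral bil f g a b I \<Longrightarrow> young_integral bil f g a b = I"
  unfolding young_integral_def using has_young_integral_unique by blast

lemma has_young_integral_real_iff:
  "has_young_integral (*) X g a b I \<longleftrightarrow>
     (\<forall>e>0. \<exists>\<delta>>0. \<forall>ts. is_partition a b ts \<and> mesh ts < \<delta> \<longrightarrow> \<bar>rsum X g ts - I\<bar> < e)"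
  unfolding has_young_integral_def rsum_def dist_real_def ..

lemma exists_fine_partition:
  assumes "a \<le> b" "0 < d"
  obtains ts where "is_partition a b ts" "mesh ts < d"
proof -
  have "eventually (\<lambda>ts. is_partition a b ts \<and> mesh ts < d) (fine_partitions a b)"
    unfolding eventually_fine_partitions using assms(2) by blast
  then show ?thesis
    using that eventually_happens'[OF fine_partitions_neq_bot[OF assms(1)]] by blast
qed

lemma has_young_integral_if_Cauchy:
  assumes ab: "a \<le> b"
    and Cauchy: "\<And>e. e > 0 \<Longrightarrow> \<exists>\<delta>>0. \<forall>P Q. is_partition a b P \<and> mesh P < \<delta> \<and>
                  is_partition a b Q \<and> mesh Q < \<delta> \<longrightarrow> \<bar>rsum X g P - rsum X g Q\<bar> < e"
  shows "\<exists>I. has_young_integral (*) X g a b I"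
proof -
  define r where "r N = rsum X g (uniform_partition a b (Suc N))" for N
  have fine: "eventually (\<lambda>N. is_partition a b (uniform_partition a b (Suc N)) \<and>
      mesh (uniform_partition a b (Suc N)) < d) sequentially" if "0 < d" for d
  proof -
    have "eventually (\<lambda>ts. is_partition a b ts \<and> mesh ts < d) (fine_partitions a b)"
      unfolding eventually_fine_partitions using that by blast
    from filterlim_uniform_partition[OF ab, unfolded filterlim_iff, rule_format, OF this]
    show ?thesis .
  qed
  have "Cauchy r"
  proof (rule metric_CauchyI)
    fix e :: real assume "0 < e"
    then obtain d where d: "d > 0" "\<forall>P Q. is_partition a b P \<and> mesh P < d \<and>
        is_partition a b Q \<and> mesh Q < d \<longrightarrow> \<bar>rsum X g P - rsum X g Q\<bar> < e"
      using Cauchy by blast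
    obtain N where N: "\<And>n. N \<le> n \<Longrightarrow> is_partition a b (uniform_partition a b (Suc n)) \<and>
        mesh (uniform_partition a b (Suc n)) < d"
      using fine[OF d(1)] unfolding eventually_sequentially by blast
    show "\<exists>M. \<forall>m\<ge>M. \<forall>n\<ge>M. dist (r m) (r n) < e"
    proof (intro exI[of _ N] allI impI)
      fix m n assume "N \<le> m" "N \<le> n"
      then show "dist (r m) (r n) < e"
        using N[of m] N[of n] d(2) unfolding r_def dist_real_def by blast
    qed
  qed
  then obtain I where I: "r \<longlonglongrightarrow> I" using Cauchy_convergent_iff convergent_def by blast
  have "has_young_integral (*) X g a b I"
    unfolding has_young_integral_real_iff
  proof (intro allI impI)
    fix e :: real assume e: "e > 0"
    then obtain d where d: "d > 0" "\<forall>P Q. is_partition a b P \<and> mesh P < d \<and>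
        is_partition a b Q \<and> mesh Q < d \<longrightarrow> \<bar>rsum X g P - rsum X g Q\<bar> < e / 2"
      using Cauchy[of "e / 2"] by auto
    have "eventually (\<lambda>N. dist (r N) I < e / 2) sequentially"
      using I half_gt_zero[OF e] unfolding tendsto_iff by blast
    with fine[OF d(1)] have "eventually (\<lambda>N. (is_partition a b (uniform_partition a b (Suc N)) \<and>
        mesh (uniform_partition a b (Suc N)) < d) \<and> dist (r N) I < e / 2) sequentially"
      by (rule eventually_conj)
    then obtain N where N: "is_partition a b (uniform_partition a b (Suc N))"
        "mesh (uniform_partition a b (Suc N)) < d" "\<bar>r N - I\<bar> < e / 2"
      unfolding dist_real_def eventually_sequentially by blast
    have "\<bar>rsum X g ts - I\<bar> < e" if "is_partition a b ts \<and> mesh ts < d" for ts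
    proof -
      have "\<bar>rsum X g ts - r N\<bar> < e / 2" using d(2) N that unfolding r_def by blast
      then show ?thesis using N(3) by linarith
    qed
    then show "\<exists>\<delta>>0. \<forall>ts. is_partition a b ts \<and> mesh ts < \<delta> \<longrightarrow> \<bar>rsum X g ts - I\<bar> < e"
      using d(1) by blast
  qed
  then show ?thesis by blast
qed

lemma strict_sorted_split_at:
  fixes Q :: "real list"
  shows "sorted_wrt (<) Q \<Longrightarrow> c \<in> set Q \<Longrightarrow>
    Q = filter (\<lambda>x. x \<le> c) Q @ tl (filter (\<lambda>x. c \<le> x) Q) \<and>
    filter (\<lambda>x. x \<le> c) Q \<noteq> [] \<and> filter (\<lambda>x. c \<le> x) Q \<noteq> [] \<and>
    last (filter (\<lambda>x. x \<le> c) Q) = c \<and> hd (filter (\<lambda>x. c \<le> x) Q) = c"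
proof (induction Q)
  case (Cons x Q)
  show ?case
  proof (cases "x = c")
    case True
    then have "filter (\<lambda>x. x \<le> c) Q = []" "filter (\<lambda>x. c \<le> x) Q = Q"
      using Cons.prems(1) by (auto simp: filter_empty_conv intro!: filter_True)
    then show ?thesis using True by simp
  next
    case False
    then show ?thesis using Cons by auto
  qed
qed simp

lemma rsum_refinement_bound:
  assumes "is_partition a b P" "is_partition a b Q" "set P \<subseteq> set Q"
    and "\<And>s t L. (s,t) \<in> set (intervals_of P) \<Longrightarrow> is_partition s t L \<Longrightarrow>
           \<bar>rsum X g L - X s * (g t - g s)\<bar> \<le> E s t"
  shows "\<bar>rsum X g Q - rsum X g P\<bar> \<le> (\<Sum>(s,t)\<leftarrow>intervals_of P. E s t)"
  using assms
proof (induction P arbitrary: a Q)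
  case (Cons x P)
  have xa: "x = a" using Cons.prems(1) by (simp add: is_partition_def)
  show ?case
  proof (cases "P = []")
    case True
    then have "Q = [a]"
      using Cons.prems(1,2) xa is_partition_degenerate by (simp add: is_partition_def)
    then show ?thesis using True xa by simp
  next
    case False
    define y where "y = hd P"
    have PP: "is_partition y b P" and ay: "a < y"
      using Cons.prems(1) False xa by (auto simp: is_partition_def y_def)
    have yQ: "y \<in> set Q" using Cons.prems(3) False by (auto simp: y_def)
    have sQ: "sorted_wrt (<) Q" and Q: "Q \<noteq> []" "hd Q = a" "last Q = b"
      using Cons.prems(2) by (auto simp: is_partition_def)
    define Q1 where "Q1 = filter (\<lambda>x. x \<le> y) Q"
    define Q2 where "Q2 = filter (\<lambda>x. y \<le> x) Q"
    have split: "Q = Q1 @ tl Q2" "Q1 \<noteq> []" "Q2 \<noteq> []" "last Q1 = y" "hd Q2 = y"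
      using strict_sorted_split_at[OF sQ yQ] by (auto simp: Q1_def Q2_def)
    have "hd Q1 = a"
      using Q ay by (cases Q) (auto simp: Q1_def)
    then have Q1P: "is_partition a y Q1"
      using split(2,4) sQ by (auto simp: is_partition_def Q1_def intro: sorted_wrt_filter)
    have "last Q2 = b"
    proof -
      have "Q = butlast Q @ [b]" using Q by (metis append_butlast_last_id)
      then have "Q2 = filter (\<lambda>x. y \<le> x) (butlast Q) @ [b]"
        using is_partition_le[OF PP] unfolding Q2_def by (metis filter.simps filter_append)
      then show ?thesis by simp
    qed
    then have Q2P: "is_partition y b Q2"
      using split(3,5) sQ by (auto simp: is_partition_def Q2_def intro: sorted_wrt_filter)
    have "set P \<subseteq> set Q2"
      using Cons.prems(3) is_partition_memD[OF PP] by (auto simp: Q2_def)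
    then have IH: "\<bar>rsum X g Q2 - rsum X g P\<bar> \<le> (\<Sum>(s,t)\<leftarrow>intervals_of P. E s t)"
      using Cons.IH[OF PP Q2P] Cons.prems(4) False by (simp add: intervals_of_Cons y_def)
    have "(a, y) \<in> set (intervals_of (x # P))" using False xa by (simp add: intervals_of_Cons y_def)
    then have "\<bar>rsum X g Q1 - X a * (g y - g a)\<bar> \<le> E a y" using Cons.prems(4) Q1P by blast
    moreover have "rsum X g Q = rsum X g Q1 + rsum X g Q2" using split by (metis rsum_append)
    moreover have "rsum X g (x # P) = X a * (g y - g a) + rsum X g P"
      using False xa by (simp add: rsum_def intervals_of_Cons y_def)
    moreover have "(\<Sum>(s,t)\<leftarrow>intervals_of (x # P). E s t) = E a y + (\<Sum>(s,t)\<leftarrow>intervals_of P. E s t)"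
      using False xa by (simp add: intervals_of_Cons y_def)
    ultimately show ?thesis using IH by linarith
  qed
qed (simp add: is_partition_def)

definition common_refinement :: "real list \<Rightarrow> real list \<Rightarrow> real list" where
  "common_refinement P Q = sorted_list_of_set (set P \<union> set Q)"

lemma common_refinement_commute: "common_refinement P Q = common_refinement Q P"
  by (simp add: common_refinement_def Un_commute)

lemma is_partition_common_refinement:
  assumes "is_partition a b P" "is_partition a b Q"
  shows "is_partition a b (common_refinement P Q)"
    and "set P \<subseteq> set (common_refinement P Q)"
proof -
  have set: "set (common_refinement P Q) = set P \<union> set Q"
    by (simp add: common_refinement_def)
  have sorted: "sorted_wrt (<) (common_refinement P Q)"
    unfolding common_refinement_def using strict_sorted_list_of_set by simp
  have ab: "a \<in> set P" "b \<in> set P"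
    using assms(1) hd_in_set[of P] last_in_set[of P] unfolding is_partition_def by auto
  have range: "\<And>x. x \<in> set (common_refinement P Q) \<Longrightarrow> a \<le> x \<and> x \<le> b"
    using is_partition_memD assms unfolding set by blast
  have ne: "common_refinement P Q \<noteq> []" using set ab by auto
  have "hd (common_refinement P Q) = a" "last (common_refinement P Q) = b"
    using strict_sorted_hd_le[OF sorted, of a] strict_sorted_le_last[OF sorted, of b] ab set
      range[OF hd_in_set[OF ne]] range[OF last_in_set[OF ne]] by auto
  then show "is_partition a b (common_refinement P Q)" using sorted ne by (simp add: is_partition_def)
  show "set P \<subseteq> set (common_refinement P Q)" using set by auto
qed

section \<open>The \<open>p\<close>-variation control\<close>

definition p_var_sum :: "real \<Rightarrow> (real \<Rightarrow> 'a::real_normed_vector) \<Rightarrow> real list \<Rightarrow> real" where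
  "p_var_sum p \<gamma> ts = (\<Sum>(s,t)\<leftarrow>intervals_of ts. norm (\<gamma> t - \<gamma> s) powr p)"

definition p_var :: "real \<Rightarrow> (real \<Rightarrow> 'a::real_normed_vector) \<Rightarrow> real \<Rightarrow> real \<Rightarrow> real" where
  "p_var p \<gamma> s t = (SUP ts\<in>{ts. is_partition s t ts}. p_var_sum p \<gamma> ts)"

lemma p_var_sum_append:
  "is_partition a c xs \<Longrightarrow> is_partition c b ys \<Longrightarrow>
     p_var_sum p \<gamma> (xs @ tl ys) = p_var_sum p \<gamma> xs + p_var_sum p \<gamma> ys"
  by (simp add: p_var_sum_def intervals_of_append is_partition_def)

lemma p_var_sum_nonneg: "0 \<le> p_var_sum p \<gamma> ts"
  unfolding p_var_sum_def by (induction ts rule: induct_list012) auto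

lemma bdd_above_p_var_sum:
  assumes bv: "bounded_p_variation p \<gamma> 0 T" and st: "0 \<le> s" "s \<le> t" "t \<le> T"
  shows "bdd_above (p_var_sum p \<gamma> ` {ts. is_partition s t ts})"
proof -
  obtain C where C: "\<And>ts. is_partition 0 T ts \<Longrightarrow> p_var_sum p \<gamma> ts \<le> C"
    using bv unfolding bounded_p_variation_def p_var_sum_def by blast
  have "p_var_sum p \<gamma> ts \<le> C" if ts: "is_partition s t ts" for ts
  proof -
    define L where "L = trivial_partition 0 s"
    define R where "R = trivial_partition t T"
    have L: "is_partition 0 s L" and R: "is_partition t T R"
      using st by (auto simp: L_def R_def intro: is_partition_trivial_partition)
    have tsR: "is_partition s T (ts @ tl R)" using is_partition_append[OF ts R] .
    have "p_var_sum p \<gamma> (L @ tl (ts @ tl R)) = p_var_sum p \<gamma> L + (p_var_sum p \<gamma> ts + p_var_sum p \<gamma> R)"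
      using p_var_sum_append[OF L tsR, where p = p and \<gamma> = \<gamma>]
        p_var_sum_append[OF ts R, where p = p and \<gamma> = \<gamma>] by simp
    moreover have "p_var_sum p \<gamma> (L @ tl (ts @ tl R)) \<le> C"
      using C is_partition_append[OF L tsR] by blast
    ultimately show ?thesis
      using p_var_sum_nonneg[of p \<gamma> L] p_var_sum_nonneg[of p \<gamma> R] by linarith
  qed
  then show ?thesis unfolding bdd_above_def by blast
qed

lemma p_var_sum_le_p_var:
  assumes "bounded_p_variation p \<gamma> 0 T" "0 \<le> s" "s \<le> t" "t \<le> T" "is_partition s t ts"
  shows "p_var_sum p \<gamma> ts \<le> p_var p \<gamma> s t"
  unfolding p_var_def using bdd_above_p_var_sum[OF assms(1-4)] assms(5) by (intro cSUP_upper) auto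

lemma norm_diff_powr_le_p_var:
  assumes "bounded_p_variation p \<gamma> 0 T" "0 \<le> s" "s \<le> t" "t \<le> T"
  shows "norm (\<gamma> t - \<gamma> s) powr p \<le> p_var p \<gamma> s t"
  using p_var_sum_le_p_var[OF assms is_partition_trivial_partition[OF assms(3)]] assms
  by (cases "s < t") (auto simp: p_var_sum_def trivial_partition_def)

lemma control_on_p_var:
  assumes bv: "bounded_p_variation p \<gamma> 0 T"
  shows "control_on (p_var p \<gamma>) 0 T"
  unfolding control_on_def
proof (intro conjI allI impI)
  fix s t assume "0 \<le> s \<and> s \<le> t \<and> t \<le> T"
  then show "0 \<le> p_var p \<gamma> s t"
    using norm_diff_powr_le_p_var[OF bv, of s t] by (meson order_trans powr_ge_zero)
next
  fix s u t assume sut: "0 \<le> s \<and> s \<le> u \<and> u \<le> t \<and> t \<le> T"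
  have ne: "{ts. is_partition a b ts} \<noteq> {}" if "a \<le> b" for a b
    using is_partition_trivial_partition[OF that] by blast
  have "p_var_sum p \<gamma> P1 + p_var p \<gamma> u t \<le> p_var p \<gamma> s t" if P1: "is_partition s u P1" for P1
  proof -
    have "p_var p \<gamma> u t \<le> p_var p \<gamma> s t - p_var_sum p \<gamma> P1"
      unfolding p_var_def[of p \<gamma> u t]
    proof (rule cSUP_least)
      fix P2 assume "P2 \<in> {ts. is_partition u t ts}"
      then have P2: "is_partition u t P2" by simp
      have "p_var_sum p \<gamma> (P1 @ tl P2) \<le> p_var p \<gamma> s t"
        using p_var_sum_le_p_var[OF bv _ _ _ is_partition_append[OF P1 P2]] sut by auto
      then show "p_var_sum p \<gamma> P2 \<le> p_var p \<gamma> s t - p_var_sum p \<gamma> P1"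
        using p_var_sum_append[OF P1 P2, where p = p and \<gamma> = \<gamma>] by linarith
    qed (use ne sut in auto)
    then show ?thesis by linarith
  qed
  then have "p_var p \<gamma> s u \<le> p_var p \<gamma> s t - p_var p \<gamma> u t"
    unfolding p_var_def[of p \<gamma> s u]
    by (intro cSUP_least) (use ne sut in \<open>auto simp: p_var_def[symmetric] algebra_simps\<close>)
  then show "p_var p \<gamma> s u + p_var p \<gamma> u t \<le> p_var p \<gamma> s t" by linarith
qed

lemma component_diff_le_p_var:
  fixes \<gamma> :: "real \<Rightarrow> real^'d"
  assumes "bounded_p_variation p \<gamma> 0 T" "0 \<le> s" "s \<le> t" "t \<le> T" "0 < p"
  shows "\<bar>\<gamma> t $ i - \<gamma> s $ i\<bar> \<le> p_var p \<gamma> s t powr (1 / p)"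
proof -
  have "\<bar>\<gamma> t $ i - \<gamma> s $ i\<bar> \<le> norm (\<gamma> t - \<gamma> s)"
    using component_le_norm_cart[of "\<gamma> t - \<gamma> s" i] by simp
  also have "\<dots> = (norm (\<gamma> t - \<gamma> s) powr p) powr (1 / p)"
    using assms(5) by (simp add: powr_powr)
  also have "\<dots> \<le> p_var p \<gamma> s t powr (1 / p)"
    using norm_diff_powr_le_p_var[OF assms(1-4)] assms(5) by (intro powr_mono2) auto
  finally show ?thesis .
qed

section \<open>Young integration against a \<open>p\<close>-variation control\<close>

lemma le_powr_interpolate:
  fixes x a b l :: real
  assumes "0 \<le> x" "x \<le> a" "x \<le> b" "0 \<le> l" "l \<le> 1"
  shows "x \<le> a powr (1 - l) * b powr l"
proof (cases "x = 0")
  case False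
  then have "x = x powr (1 - l) * x powr l" using assms by (simp add: powr_add[symmetric])
  also have "\<dots> \<le> a powr (1 - l) * b powr l"
    using assms by (intro mult_mono powr_mono2) auto
  finally show ?thesis .
qed simp

locale young_integrand =
  fixes p T :: real and \<omega> :: "real \<Rightarrow> real \<Rightarrow> real" and X g :: "real \<Rightarrow> real" and C B :: real
  assumes p_ge_1: "1 \<le> p" and p_less_2: "p < 2" and T_nonneg: "0 \<le> T"
    and control: "control_on \<omega> 0 T"
    and continuous_g: "continuous_on {0..T} g"
    and g_control: "\<And>s t. 0 \<le> s \<Longrightarrow> s \<le> t \<Longrightarrow> t \<le> T \<Longrightarrow> \<bar>g t - g s\<bar> \<le> \<omega> s t powr (1 / p)"
    and continuous_X: "continuous_on {0..T} X"
    and X_control: "\<And>s t. 0 \<le> s \<Longrightarrow> s \<le> t \<Longrightarrow> t \<le> T \<Longrightarrow> \<bar>X t - X s\<bar> \<le> C * \<omega> s t powr (1 / p)"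
    and C_nonneg: "0 \<le> C"
    and X_bounded: "\<And>t. 0 \<le> t \<Longrightarrow> t \<le> T \<Longrightarrow> \<bar>X t\<bar> \<le> B"
begin

definition "W = \<omega> 0 T"

definition "F t = young_integral (*) X g 0 t"

lemma p_pos: "0 < p"
  using p_ge_1 by simp

lemma one_less_two_div_p: "1 < 2 / p"
  using p_ge_1 p_less_2 by (simp add: field_simps)

lemma control_nonneg: "0 \<le> s \<Longrightarrow> s \<le> t \<Longrightarrow> t \<le> T \<Longrightarrow> 0 \<le> \<omega> s t"
  using control_on_nonneg[OF control] by simp

lemma control_le_W: "0 \<le> s \<Longrightarrow> s \<le> t \<Longrightarrow> t \<le> T \<Longrightarrow> \<omega> s t \<le> W"
  using control_on_mono[OF control, of 0 s t T] T_nonneg by (simp add: W_def)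

lemma B_nonneg: "0 \<le> B"
  using X_bounded[of 0] T_nonneg by linarith

lemma increment_product_bound:
  assumes "0 \<le> u" "u \<le> v" "v \<le> w" "w \<le> T"
  shows "\<bar>(X v - X u) * (g w - g v)\<bar> \<le> C * \<omega> u w powr (2 / p)"
proof -
  have "\<bar>(X v - X u) * (g w - g v)\<bar> \<le> (C * \<omega> u v powr (1 / p)) * \<omega> v w powr (1 / p)"
    unfolding abs_mult using X_control[of u v] g_control[of v w] assms by (intro mult_mono) auto
  also have "\<dots> \<le> (C * \<omega> u w powr (1 / p)) * \<omega> u w powr (1 / p)"
    using control_on_mono[OF control] control_nonneg assms C_nonneg p_pos
    by (intro mult_mono powr_mono2) auto
  also have "\<dots> = C * \<omega> u w powr (2 / p)"
    by (simp add: mult.assoc powr_add[symmetric])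
  finally show ?thesis .
qed

text \<open>If \<open>X\<close> oscillates by at most \<open>\<epsilon>\<close>, interpolating between \<open>\<epsilon>\<close> and \<open>C \<omega>\<^sup>1\<^sup>/\<^sup>p\<close> trades a
  power of \<open>\<epsilon>\<close> for the exponent \<open>1/2 + 1/p > 1\<close>, which is still admissible.\<close>
lemma increment_product_bound_small:
  assumes uvw: "0 \<le> u" "u \<le> v" "v \<le> w" "w \<le> T" and eps: "\<bar>X v - X u\<bar> \<le> \<epsilon>"
  shows "\<bar>(X v - X u) * (g w - g v)\<bar> \<le>
           (\<epsilon> powr (1 - p / 2) * C powr (p / 2)) * \<omega> u w powr (1 / 2 + 1 / p)"
proof -
  have mono: "\<omega> u v \<le> \<omega> u w" "\<omega> v w \<le> \<omega> u w" and nonneg: "0 \<le> \<omega> u v" "0 \<le> \<omega> v w"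
    using control_on_mono[OF control] control_nonneg uvw by auto
  have "\<bar>X v - X u\<bar> \<le> \<epsilon> powr (1 - p / 2) * (C * \<omega> u v powr (1 / p)) powr (p / 2)"
    using X_control[of u v] uvw eps p_less_2 p_pos by (intro le_powr_interpolate) auto
  also have "(C * \<omega> u v powr (1 / p)) powr (p / 2) = C powr (p / 2) * \<omega> u v powr (1 / 2)"
    using C_nonneg nonneg p_pos by (simp add: powr_mult powr_powr)
  finally have "\<bar>(X v - X u) * (g w - g v)\<bar> \<le>
      (\<epsilon> powr (1 - p / 2) * (C powr (p / 2) * \<omega> u v powr (1 / 2))) * \<omega> v w powr (1 / p)"
    unfolding abs_mult using g_control[of v w] uvw by (intro mult_mono) auto
  also have "\<dots> \<le> (\<epsilon> powr (1 - p / 2) * (C powr (p / 2) * \<omega> u w powr (1 / 2))) * \<omega> u w powr (1 / p)"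
    using mono nonneg C_nonneg p_pos by (intro mult_mono mult_left_mono powr_mono2) auto
  also have "\<dots> = (\<epsilon> powr (1 - p / 2) * C powr (p / 2)) * \<omega> u w powr (1 / 2 + 1 / p)"
    by (simp add: mult.assoc powr_add)
  finally show ?thesis .
qed

lemma young_loeve_bound:
  assumes "0 \<le> s" "s \<le> t" "t \<le> T" "is_partition s t L"
  shows "\<bar>rsum X g L - X s * (g t - g s)\<bar> \<le> C * young_const (2 / p) * \<omega> s t powr (2 / p)"
  using assms control_on_subinterval[OF control] increment_product_bound
  by (intro young_loeve[OF _ C_nonneg one_less_two_div_p]) auto

lemma young_loeve_bound_short:
  assumes \<eta>: "0 < \<eta>"
  obtains \<delta> where "0 < \<delta>" "\<And>s t L. 0 \<le> s \<Longrightarrow> s \<le> t \<Longrightarrow> t \<le> T \<Longrightarrow> t - s < \<delta> \<Longrightarrow>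
      is_partition s t L \<Longrightarrow> \<bar>rsum X g L - X s * (g t - g s)\<bar> \<le> \<eta> * \<omega> s t powr (1 / 2 + 1 / p)"
proof -
  define \<theta> where "\<theta> = 1 / 2 + 1 / p"
  have \<theta>: "1 < \<theta>" using p_ge_1 p_less_2 by (simp add: \<theta>_def field_simps)
  define K where "K = C powr (p / 2) * young_const \<theta>"
  have K: "0 \<le> K" using young_const_nonneg[OF \<theta>] by (simp add: K_def)
  define \<alpha> where "\<alpha> = 1 - p / 2"
  have \<alpha>: "0 < \<alpha>" using p_less_2 by (simp add: \<alpha>_def)
  define \<epsilon> where "\<epsilon> = (\<eta> / (K + 1)) powr (1 / \<alpha>)"
  have \<epsilon>: "0 < \<epsilon>" "\<epsilon> powr \<alpha> = \<eta> / (K + 1)"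
    using \<eta> K \<alpha> by (simp_all add: \<epsilon>_def powr_powr)
  have "uniformly_continuous_on {0..T} X"
    using continuous_X by (simp add: compact_uniformly_continuous)
  then obtain \<delta> where \<delta>: "\<delta> > 0"
      "\<And>u v. u \<in> {0..T} \<Longrightarrow> v \<in> {0..T} \<Longrightarrow> dist v u < \<delta> \<Longrightarrow> dist (X v) (X u) < \<epsilon>"
    unfolding uniformly_continuous_on_def using \<epsilon>(1) by metis
  have "\<bar>rsum X g L - X s * (g t - g s)\<bar> \<le> \<eta> * \<omega> s t powr \<theta>"
    if st: "0 \<le> s" "s \<le> t" "t \<le> T" "t - s < \<delta>" and L: "is_partition s t L" for s t L
  proof -
    have osc: "\<bar>X v - X u\<bar> \<le> \<epsilon>" if "s \<le> u" "u \<le> v" "v \<le> t" for u v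
      using \<delta>(2)[of u v] that st by (auto simp: dist_real_def)
    have "\<bar>rsum X g L - X s * (g t - g s)\<bar> \<le> (\<epsilon> powr \<alpha> * C powr (p / 2)) * young_const \<theta> * \<omega> s t powr \<theta>"
      using st L control_on_subinterval[OF control] increment_product_bound_small osc
      unfolding \<alpha>_def \<theta>_def by (intro young_loeve[OF _ _ \<theta>[unfolded \<theta>_def]]) auto
    also have "\<dots> = (\<eta> / (K + 1) * K) * \<omega> s t powr \<theta>"
      by (simp add: \<epsilon>(2) K_def)
    also have "\<dots> \<le> \<eta> * \<omega> s t powr \<theta>"
      using \<eta> K by (intro mult_right_mono) (simp_all add: field_simps)
    finally show ?thesis .
  qed
  then show ?thesis using that \<delta>(1) unfolding \<theta>_def by blast
qed

lemma young_integral_exists: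
  assumes t: "0 \<le> t" "t \<le> T"
  shows "\<exists>I. has_young_integral (*) X g 0 t I"
proof (rule has_young_integral_if_Cauchy[OF t(1)])
  fix e :: real assume e: "e > 0"
  define \<theta> where "\<theta> = 1 / 2 + 1 / p"
  have \<theta>: "1 < \<theta>" using p_ge_1 p_less_2 by (simp add: \<theta>_def field_simps)
  define A where "A = W powr \<theta>"
  define \<eta> where "\<eta> = e / (2 * (A + 1))"
  have A: "0 \<le> A" by (simp add: A_def)
  have \<eta>: "0 < \<eta>" "2 * (\<eta> * A) < e"
    using e A by (simp_all add: \<eta>_def field_simps)
  obtain \<delta> where \<delta>: "\<delta> > 0" "\<And>s t L. 0 \<le> s \<Longrightarrow> s \<le> t \<Longrightarrow> t \<le> T \<Longrightarrow> t - s < \<delta> \<Longrightarrow>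
      is_partition s t L \<Longrightarrow> \<bar>rsum X g L - X s * (g t - g s)\<bar> \<le> \<eta> * \<omega> s t powr \<theta>"
    using young_loeve_bound_short[OF \<eta>(1)] unfolding \<theta>_def by blast
  have refine: "\<bar>rsum X g (common_refinement P Q) - rsum X g P\<bar> \<le> \<eta> * A"
    if P: "is_partition 0 t P" "mesh P < \<delta>" and Q: "is_partition 0 t Q" for P Q
  proof -
    have "\<bar>rsum X g (common_refinement P Q) - rsum X g P\<bar> \<le>
        (\<Sum>(s,t')\<leftarrow>intervals_of P. \<eta> * \<omega> s t' powr \<theta>)"
    proof (rule rsum_refinement_bound[OF P(1) is_partition_common_refinement[OF P(1) Q]])
      fix s t' L assume int: "(s, t') \<in> set (intervals_of P)" and L: "is_partition s t' L"
      have "s \<in> set P" "t' \<in> set P" "s < t'"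
        using intervals_of_memD[OF int] intervals_of_less[OF _ int] P by (auto simp: is_partition_def)
      moreover have "t' - s < \<delta>" using P(2) int \<delta>(1) by (auto simp: mesh_less_iff)
      ultimately show "\<bar>rsum X g L - X s * (g t' - g s)\<bar> \<le> \<eta> * \<omega> s t' powr \<theta>"
        using is_partition_memD[OF P(1)] t by (intro \<delta>(2) L) force+
    qed
    also have "\<dots> = \<eta> * (\<Sum>(s,t')\<leftarrow>intervals_of P. \<omega> s t' powr \<theta>)"
      by (rule sum_list_mult_left_split)
    also have "\<dots> \<le> \<eta> * \<omega> 0 t powr \<theta>"
      using control_on_sum_powr_le[OF control _ P(1)] \<theta> t \<eta> by (intro mult_left_mono) auto
    also have "\<dots> \<le> \<eta> * A"
      unfolding A_def using control_le_W[of 0 t] control_nonneg[of 0 t] t \<eta> \<theta>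
      by (intro mult_left_mono powr_mono2) auto
    finally show ?thesis .
  qed
  have "\<bar>rsum X g P - rsum X g Q\<bar> < e"
    if "is_partition 0 t P \<and> mesh P < \<delta> \<and> is_partition 0 t Q \<and> mesh Q < \<delta>" for P Q
    using refine[of P Q] refine[of Q P] that \<eta>(2) common_refinement_commute[of P Q] by auto
  then show "\<exists>\<delta>>0. \<forall>P Q. is_partition 0 t P \<and> mesh P < \<delta> \<and> is_partition 0 t Q \<and> mesh Q < \<delta> \<longrightarrow>
      \<bar>rsum X g P - rsum X g Q\<bar> < e"
    using \<delta>(1) by blast
qed

lemma has_young_integral_F: "0 \<le> t \<Longrightarrow> t \<le> T \<Longrightarrow> has_young_integral (*) X g 0 t (F t)"
  using young_integral_exists young_integral_eq unfolding F_def by metis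

lemma F_0: "F 0 = 0"
proof -
  have "has_young_integral (*) X g 0 0 0"
    unfolding has_young_integral_def using is_partition_degenerate by auto
  then show ?thesis unfolding F_def by (rule young_integral_eq[OF order_refl])
qed

text \<open>Riemann sums over a concatenation of fine partitions of \<open>[0, s]\<close> and \<open>[s, t]\<close> approximate
  both \<open>F t\<close> and \<open>F s + rsum X g L\<close>.\<close>
lemma F_increment_bound:
  assumes st: "0 \<le> s" "s \<le> t" "t \<le> T"
    and bound: "\<And>L. is_partition s t L \<Longrightarrow> \<bar>rsum X g L - X s * (g t - g s)\<bar> \<le> E"
  shows "\<bar>F t - F s - X s * (g t - g s)\<bar> \<le> E"
proof (rule field_le_epsilon)
  fix e :: real assume e: "0 < e"
  have "\<forall>e>0. \<exists>\<delta>>0. \<forall>ts. is_partition 0 s ts \<and> mesh ts < \<delta> \<longrightarrow> \<bar>rsum X g ts - F s\<bar> < e"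
    using has_young_integral_F[of s] st unfolding has_young_integral_real_iff by simp
  from this[rule_format, OF half_gt_zero[OF e]] obtain d1 where d1: "d1 > 0"
      "\<And>ts. is_partition 0 s ts \<and> mesh ts < d1 \<Longrightarrow> \<bar>rsum X g ts - F s\<bar> < e / 2"
    by blast
  have "\<forall>e>0. \<exists>\<delta>>0. \<forall>ts. is_partition 0 t ts \<and> mesh ts < \<delta> \<longrightarrow> \<bar>rsum X g ts - F t\<bar> < e"
    using has_young_integral_F[of t] st unfolding has_young_integral_real_iff by simp
  from this[rule_format, OF half_gt_zero[OF e]] obtain d2 where d2: "d2 > 0"
      "\<And>ts. is_partition 0 t ts \<and> mesh ts < d2 \<Longrightarrow> \<bar>rsum X g ts - F t\<bar> < e / 2"
    by blast
  define d where "d = min d1 d2"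
  have d: "d > 0" using d1 d2 by (simp add: d_def)
  obtain P1 where P1: "is_partition 0 s P1" "mesh P1 < d"
    using exists_fine_partition[OF st(1) d] .
  obtain P2 where P2: "is_partition s t P2" "mesh P2 < d"
    using exists_fine_partition[OF st(2) d] .
  have P: "is_partition 0 t (P1 @ tl P2)" "mesh (P1 @ tl P2) < d"
    using is_partition_append[OF P1(1) P2(1)] mesh_append_less[OF P1(1) P2(1) P1(2) P2(2) d] .
  have "rsum X g (P1 @ tl P2) = rsum X g P1 + rsum X g P2"
    using is_partitionD[OF P1(1)] is_partitionD[OF P2(1)] by (intro rsum_append) auto
  moreover have "\<bar>rsum X g P1 - F s\<bar> < e / 2" using d1(2)[of P1] P1 by (simp add: d_def)
  moreover have "\<bar>rsum X g (P1 @ tl P2) - F t\<bar> < e / 2" using d2(2)[of "P1 @ tl P2"] P by (simp add: d_def)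
  moreover have "\<bar>rsum X g P2 - X s * (g t - g s)\<bar> \<le> E" using bound[OF P2(1)] .
  ultimately show "\<bar>F t - F s - X s * (g t - g s)\<bar> \<le> E + e" by linarith
qed

definition "K = B + C * young_const (2 / p) * W powr (1 / p)"

lemma K_nonneg: "0 \<le> K"
  unfolding K_def using B_nonneg C_nonneg young_const_nonneg[OF one_less_two_div_p] by simp

lemma F_control:
  assumes st: "0 \<le> s" "s \<le> t" "t \<le> T"
  shows "\<bar>F t - F s\<bar> \<le> K * \<omega> s t powr (1 / p)"
proof -
  have \<omega>: "0 \<le> \<omega> s t" "\<omega> s t \<le> W" using control_nonneg control_le_W st by auto
  have "\<bar>X s * (g t - g s)\<bar> \<le> B * \<omega> s t powr (1 / p)"
    unfolding abs_mult using X_bounded[of s] g_control[OF st] st B_nonneg by (intro mult_mono) auto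
  moreover have "\<omega> s t powr (2 / p) \<le> W powr (1 / p) * \<omega> s t powr (1 / p)"
    using \<omega> p_pos powr_add[of "\<omega> s t" "1 / p" "1 / p"]
    by (simp add: mult_right_mono powr_mono2)
  then have "C * young_const (2 / p) * \<omega> s t powr (2 / p) \<le>
      C * young_const (2 / p) * (W powr (1 / p) * \<omega> s t powr (1 / p))"
    using C_nonneg young_const_nonneg[OF one_less_two_div_p] by (intro mult_left_mono) auto
  ultimately show ?thesis
    using F_increment_bound[OF st young_loeve_bound[OF st]] unfolding K_def by (simp add: algebra_simps)
qed

lemma F_bounded:
  assumes t: "0 \<le> t" "t \<le> T"
  shows "\<bar>F t\<bar> \<le> K * W powr (1 / p)"
proof -
  have "\<bar>F t\<bar> \<le> K * \<omega> 0 t powr (1 / p)" using F_control[of 0 t] t F_0 by simp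
  also have "\<dots> \<le> K * W powr (1 / p)"
    using control_nonneg[of 0 t] control_le_W[of 0 t] t K_nonneg p_pos
    by (intro mult_left_mono powr_mono2) auto
  finally show ?thesis .
qed

lemma continuous_on_F: "continuous_on {0..T} F"
proof -
  have "uniformly_continuous_on {0..T} F"
    unfolding uniformly_continuous_on_def
  proof (intro allI impI)
    fix e :: real assume e: "0 < e"
    define A where "A = W powr (1 / 2 + 1 / p)"
    define \<eta> where "\<eta> = e / (2 * (A + 1))"
    have A: "0 \<le> A" by (simp add: A_def)
    have \<eta>: "0 < \<eta>" "\<eta> * A < e / 2"
      using e A by (simp_all add: \<eta>_def field_simps)
    obtain d1 where d1: "d1 > 0" "\<And>s t L. 0 \<le> s \<Longrightarrow> s \<le> t \<Longrightarrow> t \<le> T \<Longrightarrow> t - s < d1 \<Longrightarrow>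
        is_partition s t L \<Longrightarrow> \<bar>rsum X g L - X s * (g t - g s)\<bar> \<le> \<eta> * \<omega> s t powr (1 / 2 + 1 / p)"
      using young_loeve_bound_short[OF \<eta>(1)] by blast
    define e' where "e' = e / (2 * (B + 1))"
    have e': "0 < e'" "B * e' < e / 2"
      using e B_nonneg by (simp_all add: e'_def field_simps)
    have "uniformly_continuous_on {0..T} g"
      using continuous_g by (simp add: compact_uniformly_continuous)
    then obtain d2 where d2: "d2 > 0"
        "\<And>u v. u \<in> {0..T} \<Longrightarrow> v \<in> {0..T} \<Longrightarrow> dist v u < d2 \<Longrightarrow> dist (g v) (g u) < e'"
      unfolding uniformly_continuous_on_def using e'(1) by metis
    define d where "d = min d1 d2"
    have close: "\<bar>F t - F s\<bar> < e" if st: "0 \<le> s" "s \<le> t" "t \<le> T" "t - s < d" for s t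
    proof -
      have "\<bar>F t - F s - X s * (g t - g s)\<bar> \<le> \<eta> * \<omega> s t powr (1 / 2 + 1 / p)"
        using st d1(2) by (intro F_increment_bound) (auto simp: d_def)
      also have "\<dots> \<le> \<eta> * A"
        unfolding A_def using control_nonneg[of s t] control_le_W[of s t] st \<eta>(1) p_pos
        by (intro mult_left_mono powr_mono2) auto
      finally have "\<bar>F t - F s - X s * (g t - g s)\<bar> < e / 2" using \<eta>(2) by linarith
      moreover have "\<bar>X s * (g t - g s)\<bar> \<le> B * e'"
        unfolding abs_mult using X_bounded[of s] d2(2)[of s t] st B_nonneg
        by (intro mult_mono) (auto simp: d_def dist_real_def)
      ultimately show ?thesis using e'(2) by linarith
    qed
    show "\<exists>d>0. \<forall>x\<in>{0..T}. \<forall>x'\<in>{0..T}. dist x' x < d \<longrightarrow> dist (F x') (F x) < e"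
    proof (intro exI[of _ d] conjI ballI impI)
      fix x x' assume "x \<in> {0..T}" "x' \<in> {0..T}" "dist x' x < d"
      then show "dist (F x') (F x) < e"
        using close[of x x'] close[of x' x] by (cases "x \<le> x'") (auto simp: dist_real_def abs_minus_commute)
    qed (use d1 d2 in \<open>simp add: d_def\<close>)
  qed
  then show ?thesis by (rule uniformly_continuous_imp_continuous)
qed

end

section \<open>Signature coordinates of a path of bounded \<open>p\<close>-variation\<close>

locale p_var_path =
  fixes p T :: real and \<gamma> :: "real \<Rightarrow> real^'d"
  assumes p_ge_1: "1 \<le> p" and p_less_2: "p < 2" and T_nonneg: "0 \<le> T"
    and continuous_\<gamma>: "continuous_on {0..T} \<gamma>" and bounded_variation: "bounded_p_variation p \<gamma> 0 T"
begin

abbreviation "\<omega> \<equiv> p_var p \<gamma>"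

definition "W = \<omega> 0 T"

definition "K = young_const (2 / p)"

definition "R = (1 + K * W powr (1 / p)) * (1 + W powr (1 / p))"

lemma p_pos: "0 < p"
  using p_ge_1 by simp

lemma control: "control_on \<omega> 0 T"
  using control_on_p_var[OF bounded_variation] .

lemma K_nonneg: "0 \<le> K"
  unfolding K_def using p_ge_1 p_less_2 by (intro young_const_nonneg) (simp add: field_simps)

lemma R_ge_1: "1 \<le> R"
proof -
  have "1 * 1 \<le> (1 + K * W powr (1 / p)) * (1 + W powr (1 / p))"
    using K_nonneg by (intro mult_mono) auto
  then show ?thesis unfolding R_def by simp
qed

lemma young_integrand_sig_rev:
  assumes "continuous_on {0..T} (sig_rev \<gamma> v)"
    and "\<And>s t. 0 \<le> s \<Longrightarrow> s \<le> t \<Longrightarrow> t \<le> T \<Longrightarrow>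
           \<bar>sig_rev \<gamma> v t - sig_rev \<gamma> v s\<bar> \<le> R ^ length v * \<omega> s t powr (1 / p)"
    and "\<And>t. 0 \<le> t \<Longrightarrow> t \<le> T \<Longrightarrow> \<bar>sig_rev \<gamma> v t\<bar> \<le> R ^ length v"
  shows "young_integrand p T \<omega> (sig_rev \<gamma> v) (\<lambda>s. \<gamma> s $ a) (R ^ length v) (R ^ length v)"
proof
  show "continuous_on {0..T} (\<lambda>s. \<gamma> s $ a)"
    using continuous_\<gamma> by (rule continuous_on_component)
  show "\<And>s t. 0 \<le> s \<Longrightarrow> s \<le> t \<Longrightarrow> t \<le> T \<Longrightarrow> \<bar>\<gamma> t $ a - \<gamma> s $ a\<bar> \<le> \<omega> s t powr (1 / p)"
    using component_diff_le_p_var[OF bounded_variation _ _ _ p_pos] by blast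
  show "0 \<le> R ^ length v"
    using R_ge_1 by simp
qed (use p_ge_1 p_less_2 T_nonneg control assms in auto)

lemma sig_rev_regular:
  "continuous_on {0..T} (sig_rev \<gamma> v) \<and>
   (\<forall>s t. 0 \<le> s \<longrightarrow> s \<le> t \<longrightarrow> t \<le> T \<longrightarrow>
      \<bar>sig_rev \<gamma> v t - sig_rev \<gamma> v s\<bar> \<le> R ^ length v * \<omega> s t powr (1 / p)) \<and>
   (\<forall>t. 0 \<le> t \<longrightarrow> t \<le> T \<longrightarrow> \<bar>sig_rev \<gamma> v t\<bar> \<le> R ^ length v)"
proof (induction v)
  case (Cons a v)
  interpret Y: young_integrand p T \<omega> "sig_rev \<gamma> v" "\<lambda>s. \<gamma> s $ a" "R ^ length v" "R ^ length v"
    using Cons.IH by (intro young_integrand_sig_rev) blast+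
  have F: "sig_rev \<gamma> (a # v) = Y.F"
    by (simp add: Y.F_def fun_eq_iff)
  have YK: "Y.K = R ^ length v * (1 + K * W powr (1 / p))"
    unfolding Y.K_def Y.W_def W_def K_def by (simp add: algebra_simps)
  have "1 + K * W powr (1 / p) \<le> R" "(1 + K * W powr (1 / p)) * W powr (1 / p) \<le> R"
    unfolding R_def using K_nonneg mult_left_mono[of 1 "1 + W powr (1 / p)" "1 + K * W powr (1 / p)"]
      by (auto intro!: mult_left_mono)
  then have K_le: "Y.K \<le> R ^ length (a # v)" and KW_le: "Y.K * W powr (1 / p) \<le> R ^ length (a # v)"
    unfolding YK using R_ge_1 by (simp_all add: mult.commute mult.left_commute mult_left_mono)
  show ?case
  proof (intro conjI allI impI)
    show "continuous_on {0..T} (sig_rev \<gamma> (a # v))"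
      unfolding F by (rule Y.continuous_on_F)
  next
    fix s t :: real assume st: "0 \<le> s" "s \<le> t" "t \<le> T"
    have "\<bar>Y.F t - Y.F s\<bar> \<le> Y.K * \<omega> s t powr (1 / p)"
      using Y.F_control[OF st] .
    also have "\<dots> \<le> R ^ length (a # v) * \<omega> s t powr (1 / p)"
      using K_le by (intro mult_right_mono) auto
    finally show "\<bar>sig_rev \<gamma> (a # v) t - sig_rev \<gamma> (a # v) s\<bar> \<le> R ^ length (a # v) * \<omega> s t powr (1 / p)"
      unfolding F .
  next
    fix t :: real assume "0 \<le> t" "t \<le> T"
    then show "\<bar>sig_rev \<gamma> (a # v) t\<bar> \<le> R ^ length (a # v)"
      using Y.F_bounded KW_le unfolding F Y.W_def W_def by fastforce
  qed
qed simp

lemma has_young_integral_sig_rev: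
  assumes "0 \<le> t" "t \<le> T"
  shows "has_young_integral (*) (sig_rev \<gamma> v) (\<lambda>s. \<gamma> s $ a) 0 t (sig_rev \<gamma> (a # v) t)"
proof -
  interpret Y: young_integrand p T \<omega> "sig_rev \<gamma> v" "\<lambda>s. \<gamma> s $ a" "R ^ length v" "R ^ length v"
    using sig_rev_regular by (intro young_integrand_sig_rev) blast+
  show ?thesis using Y.has_young_integral_F[OF assms] by (simp add: Y.F_def)
qed

lemma sig_rev_bound: "0 \<le> t \<Longrightarrow> t \<le> T \<Longrightarrow> \<bar>sig_rev \<gamma> v t\<bar> \<le> R ^ length v"
  using sig_rev_regular by blast

end

section \<open>The development as a sum over words\<close>

lemma matrix_add_rdistrib: "((A::'a::semiring_1^'n^'m) + B) ** C = A ** C + B ** C"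
  by (vector matrix_matrix_mult_def sum.distrib[symmetric] field_simps)

lemma matrix_mult_sum_left: "(\<Sum>i\<in>I. f i) ** (C::'a::semiring_1^'n^'m) = (\<Sum>i\<in>I. f i ** C)"
  by (induction I rule: infinite_finite_induct) (auto simp: matrix_add_rdistrib)

lemma matrix_mult_sum_right: "(C::'a::semiring_1^'n^'m) ** (\<Sum>i\<in>I. f i) = (\<Sum>i\<in>I. C ** f i)"
  by (induction I rule: infinite_finite_induct) (auto simp: matrix_add_ldistrib)

fun word_prod :: "(real^'d \<Rightarrow> 'a::semiring_1^'k^'k) \<Rightarrow> 'd list \<Rightarrow> 'a^'k^'k" where
  "word_prod M [] = mat 1"
| "word_prod M (a # w) = M (axis a 1) ** word_prod M w"

lemma word_prod_snoc: "word_prod M (w @ [a]) = word_prod M w ** M (axis a 1)"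
  by (induction w) (auto simp: matrix_mul_assoc)

lemma linear_eq_sum_axis:
  fixes M :: "real^'d \<Rightarrow> 'b::real_vector"
  assumes "linear M"
  shows "M x = (\<Sum>a\<in>UNIV. x $ a *\<^sub>R M (axis a 1))"
proof -
  have "M x = M (\<Sum>a\<in>UNIV. x $ a *\<^sub>R axis a 1)"
    using basis_expansion[of x] by (simp add: scalar_mult_eq_scaleR)
  also have "\<dots> = (\<Sum>a\<in>UNIV. x $ a *\<^sub>R M (axis a 1))"
    unfolding real_vector.linear_sum[OF assms] linear_cmul[OF assms] ..
  finally show ?thesis .
qed

lemma sum_list_sum_sum_swap:
  "(\<Sum>x\<leftarrow>xs. \<Sum>i\<in>I. \<Sum>j\<in>J. c i j x *\<^sub>R (A i j :: 'b::real_vector)) =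
   (\<Sum>i\<in>I. \<Sum>j\<in>J. (\<Sum>x\<leftarrow>xs. c i j x) *\<^sub>R A i j)"
  by (induction xs) (auto simp: sum.distrib scaleR_add_left)

lemma finite_words: "finite {v :: 'd::finite list. length v = n}"
  using finite_lists_length_eq[of "UNIV :: 'd set" n] by simp

lemma sum_words_Suc:
  "(\<Sum>v\<in>{v :: 'd::finite list. length v = Suc n}. f v) = (\<Sum>v\<in>{v. length v = n}. \<Sum>a\<in>UNIV. f (a # v))"
proof -
  have "(\<Sum>v\<in>{v :: 'd list. length v = Suc n}. f v) = (\<Sum>(a, v)\<in>UNIV \<times> {v. length v = n}. f (a # v))"
    by (rule sum.reindex_bij_witness[of _ "\<lambda>(a, v). a # v" "\<lambda>v. (hd v, tl v)"])
       (auto simp: length_Suc_conv)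
  also have "\<dots> = (\<Sum>v\<in>{v. length v = n}. \<Sum>a\<in>UNIV. f (a # v))"
    by (subst sum.cartesian_product[symmetric]) (rule sum.swap)
  finally show ?thesis .
qed

context p_var_path
begin

text \<open>The words are stored reversed in \<^const>\<open>sig_rev\<close>, hence the \<^const>\<open>rev\<close>.\<close>
lemma dev_term_eq_sum_words:
  assumes M: "linear M"
  shows "0 \<le> t \<Longrightarrow> t \<le> T \<Longrightarrow>
    dev_term M \<gamma> n t = (\<Sum>v\<in>{v. length v = n}. sig_rev \<gamma> v t *\<^sub>R word_prod M (rev v))"
proof (induction n arbitrary: t)
  case 0
  have "{v :: 'd list. length v = 0} = {[]}" by auto
  then show ?case by simp
next
  case (Suc n)
  let ?E = "\<lambda>a. M (axis a 1)"
  let ?g = "\<lambda>a s. \<gamma> s $ a"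
  define S where "S ts = (\<Sum>v\<in>{v. length v = n}. \<Sum>a\<in>UNIV.
      rsum (sig_rev \<gamma> v) (?g a) ts *\<^sub>R (word_prod M (rev v) ** ?E a))" for ts
  have "(S \<longlongrightarrow> (\<Sum>v\<in>{v. length v = n}. \<Sum>a\<in>UNIV.
      sig_rev \<gamma> (a # v) t *\<^sub>R (word_prod M (rev v) ** ?E a))) (fine_partitions 0 t)"
    unfolding S_def
  proof (intro tendsto_sum tendsto_scaleR tendsto_const)
    fix v :: "'d list" and a :: 'd
    show "((\<lambda>ts. rsum (sig_rev \<gamma> v) (?g a) ts) \<longlongrightarrow> sig_rev \<gamma> (a # v) t) (fine_partitions 0 t)"
      using has_young_integral_sig_rev[OF Suc.prems]
      unfolding has_young_integral_iff_tendsto rsum_def .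
  qed
  moreover have "(\<Sum>(s,t')\<leftarrow>intervals_of ts. dev_term M \<gamma> n s ** (M (\<gamma> t') - M (\<gamma> s))) = S ts"
    if ts: "is_partition 0 t ts" for ts
  proof -
    have "dev_term M \<gamma> n s ** (M (\<gamma> t') - M (\<gamma> s)) =
      (\<Sum>v\<in>{v. length v = n}. \<Sum>a\<in>UNIV.
         (sig_rev \<gamma> v s * (?g a t' - ?g a s)) *\<^sub>R (word_prod M (rev v) ** ?E a))"
      if st: "(s, t') \<in> set (intervals_of ts)" for s t'
    proof -
      have s: "0 \<le> s" "s \<le> T"
        using intervals_of_memD[OF st] is_partition_memD[OF ts] Suc.prems by force+
      have dM: "M (\<gamma> t') - M (\<gamma> s) = (\<Sum>a\<in>UNIV. (?g a t' - ?g a s) *\<^sub>R ?E a)"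
        using linear_eq_sum_axis[OF M, of "\<gamma> t' - \<gamma> s"] real_vector.linear_diff[OF M] by simp
      show ?thesis
        unfolding Suc.IH[OF s] dM matrix_mult_sum_left matrix_mult_sum_right scaleR_sum_right
          scaleR_scaleR scalar_matrix_assoc[symmetric] matrix_scalar_ac
        by (rule_tac trans[OF sum.swap]) (simp add: mult.commute)
    qed
    then have "(\<Sum>(s,t')\<leftarrow>intervals_of ts. dev_term M \<gamma> n s ** (M (\<gamma> t') - M (\<gamma> s))) =
      (\<Sum>x\<leftarrow>intervals_of ts. \<Sum>v\<in>{v. length v = n}. \<Sum>a\<in>UNIV.
         (case x of (s, t') \<Rightarrow> sig_rev \<gamma> v s * (?g a t' - ?g a s)) *\<^sub>R (word_prod M (rev v) ** ?E a))"
      by (intro arg_cong[where f = sum_list] map_cong) auto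
    also have "\<dots> = S ts"
      unfolding sum_list_sum_sum_swap S_def rsum_def by (simp add: case_prod_beta)
    finally show ?thesis .
  qed
  then have "eventually (\<lambda>ts. (\<Sum>(s,t')\<leftarrow>intervals_of ts. dev_term M \<gamma> n s ** (M (\<gamma> t') - M (\<gamma> s))) =
      S ts) (fine_partitions 0 t)"
    using eventually_is_partition_fine_partitions by (rule eventually_mono[rotated]) blast
  ultimately have "has_young_integral (**) (dev_term M \<gamma> n) (\<lambda>s. M (\<gamma> s)) 0 t
      (\<Sum>v\<in>{v. length v = n}. \<Sum>a\<in>UNIV. sig_rev \<gamma> (a # v) t *\<^sub>R (word_prod M (rev v) ** ?E a))"
    unfolding has_young_integral_iff_tendsto by (simp add: tendsto_cong)
  then show ?case
    using young_integral_eq Suc.prems by (simp add: sum_words_Suc word_prod_snoc)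
qed

end

section \<open>Development along a word matrix\<close>

lemma idx_pos_less: "(i::'k::{finite,linorder}) < j \<Longrightarrow> idx_pos i < idx_pos j"
  unfolding idx_pos_def by (rule psubset_card_mono) auto

lemma idx_pos_eq_iff: "idx_pos (i::'k::{finite,linorder}) = idx_pos j \<longleftrightarrow> i = j"
  using idx_pos_less[of i j] idx_pos_less[of j i] by (cases i j rule: linorder_cases) auto

lemma idx_pos_less_card: "idx_pos (i::'k::{finite,linorder}) < CARD('k)"
  unfolding idx_pos_def by (rule psubset_card_mono) auto

lemma range_idx_pos: "range (idx_pos :: 'k::{finite,linorder} \<Rightarrow> nat) = {..<CARD('k)}"
proof (rule card_subset_eq)
  have "inj (idx_pos :: 'k \<Rightarrow> nat)" using idx_pos_eq_iff by (auto intro: injI)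
  then show "card (range (idx_pos :: 'k \<Rightarrow> nat)) = card {..<CARD('k)}"
    by (simp add: card_image)
qed (use idx_pos_less_card in auto)

lemma exists_idx_pos: "m < CARD('k::{finite,linorder}) \<Longrightarrow> \<exists>i::'k. idx_pos i = m"
  using range_idx_pos by (metis imageE lessThan_iff)

definition word_matrix :: "'d list \<Rightarrow> real^'d \<Rightarrow> ((complex, 'k::{finite,linorder}) vec, 'k) vec" where
  "word_matrix w x = (\<chi> i j. complex_of_real
     (if idx_pos j = idx_pos i + 1 \<and> idx_pos i < length w then x $ (w ! idx_pos i)
      else if idx_pos i = idx_pos j + 1 \<and> idx_pos j < length w then - (x $ (w ! idx_pos j)) else 0))"

lemma linear_word_matrix: "linear (word_matrix w)"
  by (rule linearI) (auto simp: word_matrix_def vec_eq_iff scaleR_conv_of_real[where 'a = complex])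

lemma word_matrix_in_tk_real: "word_matrix w x \<in> tk_real"
  unfolding tk_real_def word_matrix_def by auto

lemma word_matrix_axis:
  "word_matrix w (axis a 1) $ i $ j = complex_of_real
     (if idx_pos j = idx_pos i + 1 \<and> idx_pos i < length w then (if w ! idx_pos i = a then 1 else 0)
      else if idx_pos i = idx_pos j + 1 \<and> idx_pos j < length w then - (if w ! idx_pos j = a then 1 else 0)
      else 0)"
  by (simp add: word_matrix_def axis_def)

lemma word_prod_word_matrix_scaleR:
  "word_prod (\<lambda>x. word_matrix w (c *\<^sub>R x)) u = (c ^ length u) *\<^sub>R word_prod (word_matrix w) u"
  by (induction u)
    (auto simp: linear_cmul[OF linear_word_matrix] scalar_matrix_assoc[symmetric] matrix_scalar_ac)

lemma word_prod_word_matrix_eq_0: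
  "idx_pos i + length u < idx_pos j \<Longrightarrow> word_prod (word_matrix w) u $ i $ (j::'k::{finite,linorder}) = 0"
proof (induction u arbitrary: i)
  case Nil
  then show ?case by (auto simp: mat_def)
next
  case (Cons a u)
  have "word_matrix w (axis a 1) $ i $ l * word_prod (word_matrix w) u $ l $ j = 0" for l
    using Cons.IH[of l] Cons.prems by (auto simp: word_matrix_axis)
  then have "(\<Sum>l\<in>UNIV. word_matrix w (axis a 1) $ i $ l * word_prod (word_matrix w) u $ l $ j) = 0"
    by (intro sum.neutral) blast
  then show ?case by (simp add: matrix_matrix_mult_def)
qed

lemma word_prod_word_matrix_diagonal:
  "idx_pos j = idx_pos i + length u \<Longrightarrow>
   word_prod (word_matrix w) u $ i $ (j::'k::{finite,linorder}) =
     (if \<forall>l<length u. idx_pos i + l < length w \<and> u ! l = w ! (idx_pos i + l) then 1 else 0)"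
proof (induction u arbitrary: i)
  case Nil
  then show ?case using idx_pos_eq_iff[of j i] by (simp add: mat_def)
next
  case (Cons a u)
  have "idx_pos i + 1 < CARD('k)"
    using Cons.prems idx_pos_less_card[of j] by simp
  then obtain i' :: 'k where i': "idx_pos i' = idx_pos i + 1"
    using exists_idx_pos by blast
  have zero: "word_matrix w (axis a 1) $ i $ l * word_prod (word_matrix w) u $ l $ j = 0"
    if "l \<noteq> i'" for l
  proof (cases "idx_pos i = idx_pos l + 1")
    case True
    then show ?thesis using word_prod_word_matrix_eq_0[of l u j w] Cons.prems by simp
  next
    case False
    moreover have "idx_pos l \<noteq> idx_pos i + 1" using that i' idx_pos_eq_iff by metis
    ultimately show ?thesis by (simp add: word_matrix_axis)
  qed
  have "(\<Sum>l\<in>UNIV - {i'}. word_matrix w (axis a 1) $ i $ l * word_prod (word_matrix w) u $ l $ j) = 0"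
    using zero by (intro sum.neutral) blast
  then have "word_prod (word_matrix w) (a # u) $ i $ j =
      word_matrix w (axis a 1) $ i $ i' * word_prod (word_matrix w) u $ i' $ j"
    unfolding word_prod.simps matrix_matrix_mult_def by (simp add: sum.remove[of UNIV i'])
  also have "\<dots> = (if idx_pos i < length w \<and> w ! idx_pos i = a then 1 else 0) *
      (if \<forall>l<length u. idx_pos i' + l < length w \<and> u ! l = w ! (idx_pos i' + l) then 1 else 0)"
    using Cons.IH[of i'] Cons.prems i' by (simp add: word_matrix_axis)
  also have "\<dots> = (if \<forall>l<length (a # u). idx_pos i + l < length w \<and> (a # u) ! l = w ! (idx_pos i + l)
      then 1 else 0)"
    unfolding i' by (auto simp: All_less_Suc2 ac_simps)
  finally show ?case .
qed

lemma norm_word_prod_word_matrix_le: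
  "norm (word_prod (word_matrix w) u $ i $ (j::'k::{finite,linorder})) \<le> real CARD('k) ^ length u"
proof (induction u arbitrary: i)
  case Nil
  then show ?case by (simp add: mat_def)
next
  case (Cons a u)
  have "norm (word_prod (word_matrix w) (a # u) $ i $ j) \<le>
      (\<Sum>l\<in>UNIV. norm (word_matrix w (axis a 1) $ i $ l * word_prod (word_matrix w) u $ l $ j))"
    unfolding word_prod.simps matrix_matrix_mult_def by (simp add: norm_sum)
  also have "\<dots> \<le> (\<Sum>l\<in>(UNIV::'k set). real CARD('k) ^ length u)"
  proof (rule sum_mono)
    fix l :: 'k
    have "norm (word_matrix w (axis a 1) $ i $ l) \<le> 1" by (simp add: word_matrix_axis)
    then show "norm (word_matrix w (axis a 1) $ i $ l * word_prod (word_matrix w) u $ l $ j) \<le>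
        real CARD('k) ^ length u"
      unfolding norm_mult using Cons.IH[of l] mult_mono[of _ 1 _ "real CARD('k) ^ length u"] by simp
  qed
  finally show ?case by simp
qed

text \<open>The coefficient of \<open>c\<^sup>m\<close> in the entry \<open>(i, j)\<close> of the development at \<open>c M\<^sub>w\<close>.\<close>
definition word_dev_coeff ::
  "(real \<Rightarrow> real^'d) \<Rightarrow> real \<Rightarrow> 'd list \<Rightarrow> nat \<Rightarrow> 'k::{finite,linorder} \<Rightarrow> 'k \<Rightarrow> complex" where
  "word_dev_coeff \<gamma> T w m i j =
     (\<Sum>v\<in>{v. length v = m}. complex_of_real (sig_rev \<gamma> v T) * word_prod (word_matrix w) (rev v) $ i $ j)"

lemma word_dev_coeff_below:
  assumes "m < length w" "idx_pos i = 0" "idx_pos j = length w"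
  shows "word_dev_coeff \<gamma> T w m i j = 0"
  unfolding word_dev_coeff_def using word_prod_word_matrix_eq_0[of i "rev _" j w] assms
  by (intro sum.neutral) auto

lemma word_dev_coeff_length:
  assumes "idx_pos i = 0" "idx_pos j = length w"
  shows "word_dev_coeff \<gamma> T w (length w) i j = complex_of_real (sig_coord \<gamma> T w)"
proof -
  have "word_prod (word_matrix w) (rev v) $ i $ j = (if v = rev w then 1 else 0)"
    if v: "length v = length w" for v
  proof -
    have "(\<forall>l<length w. l < length w \<and> rev v ! l = w ! l) \<longleftrightarrow> v = rev w"
      using v by (simp add: rev_swap[symmetric] list_eq_iff_nth_eq[of "rev v" w])
    then show ?thesis
      using word_prod_word_matrix_diagonal[of j i "rev v" w] assms v by simp
  qed
  then have "word_dev_coeff \<gamma> T w (length w) i j =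
      (\<Sum>v\<in>{v. length v = length w}. if v = rev w then complex_of_real (sig_rev \<gamma> v T) else 0)"
    unfolding word_dev_coeff_def by (intro sum.cong) auto
  also have "\<dots> = complex_of_real (sig_coord \<gamma> T w)"
    using finite_words by (subst sum.delta) (auto simp: sig_coord_def)
  finally show ?thesis .
qed

lemma linear_scaled_word_matrix: "linear (\<lambda>x. word_matrix w (c *\<^sub>R x))"
  using linear_compose[OF linear_scale_self linear_word_matrix] by (simp add: o_def)

context p_var_path
begin

lemma dev_term_scaled_word_matrix:
  "dev_term (\<lambda>x. word_matrix w (c *\<^sub>R x)) \<gamma> m T $ i $ j = word_dev_coeff \<gamma> T w m i j * complex_of_real c ^ m"
proof -
  have eq: "dev_term (\<lambda>x. word_matrix w (c *\<^sub>R x)) \<gamma> m T =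
      (\<Sum>v\<in>{v. length v = m}. (sig_rev \<gamma> v T * c ^ m) *\<^sub>R word_prod (word_matrix w) (rev v))"
    using dev_term_eq_sum_words[OF linear_scaled_word_matrix, where t = T and n = m] T_nonneg
    by (simp add: word_prod_word_matrix_scaleR)
  show ?thesis
    unfolding eq word_dev_coeff_def sum_component vector_scaleR_component sum_distrib_right
    by (simp add: scaleR_conv_of_real[where 'a = complex] ac_simps)
qed

lemma norm_word_dev_coeff_le:
  "norm (word_dev_coeff \<gamma> T w m i (j::'k::{finite,linorder})) \<le> (real CARD('d) * R * real CARD('k)) ^ m"
proof -
  have "norm (word_dev_coeff \<gamma> T w m i j) \<le> (\<Sum>v\<in>{v::'d list. length v = m}. R ^ m * real CARD('k) ^ m)"
    unfolding word_dev_coeff_def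
  proof (rule order.trans[OF norm_sum sum_mono])
    fix v :: "'d list" assume "v \<in> {v. length v = m}"
    then show "norm (complex_of_real (sig_rev \<gamma> v T) * word_prod (word_matrix w) (rev v) $ i $ j) \<le>
        R ^ m * real CARD('k) ^ m"
      unfolding norm_mult using sig_rev_bound[of T v] T_nonneg norm_word_prod_word_matrix_le[of w "rev v" i j]
      by (intro mult_mono) auto
  qed
  also have "\<dots> = (real CARD('d) * R * real CARD('k)) ^ m"
    using card_lists_length_eq[of "UNIV :: 'd set" m] by (simp add: power_mult_distrib)
  finally show ?thesis .
qed

text \<open>For \<open>\<bar>c\<bar>\<close> small, every entry of \<open>dev_term\<close> is at most \<open>(1/2)\<^sup>m\<close>, so the series defining
  the development converges absolutely and can be read entrywise.\<close>
lemma development_scaled_word_matrix_sums: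
  fixes i j :: "'k::{finite,linorder}"
  obtains r where "0 < r"
    and "\<And>c. \<bar>c\<bar> < r \<Longrightarrow> (\<lambda>m. word_dev_coeff \<gamma> T w m i j * complex_of_real c ^ m) sums
           (development \<gamma> T (\<lambda>x. word_matrix w (c *\<^sub>R x)) $ i $ j)"
proof
  define Q where "Q = real CARD('d) * R * real CARD('k)"
  have "1 \<le> real CARD('d)" "1 \<le> real CARD('k)"
    by (simp_all add: Suc_le_eq)
  then have Q: "1 \<le> Q"
    unfolding Q_def using R_ge_1 mult_mono[of 1 "real CARD('d)" 1 R] mult_mono[of 1 _ 1 "real CARD('k)"]
    by simp
  show "0 < 1 / (2 * Q)" using Q by simp
  fix c :: real assume "\<bar>c\<bar> < 1 / (2 * Q)"
  then have cQ: "\<bar>c\<bar> * Q \<le> 1 / 2" using Q by (simp add: field_simps)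
  define D where "D m = (dev_term (\<lambda>x. word_matrix w (c *\<^sub>R x)) \<gamma> m T :: ((complex, 'k) vec, 'k) vec)" for m
  have entry_le: "norm (D m $ i' $ j') \<le> (1 / 2) ^ m" for m i' j'
  proof -
    have "norm (D m $ i' $ j') \<le> Q ^ m * \<bar>c\<bar> ^ m"
      unfolding D_def dev_term_scaled_word_matrix norm_mult norm_power norm_of_real Q_def
      by (intro mult_right_mono norm_word_dev_coeff_le) auto
    also have "\<dots> = (\<bar>c\<bar> * Q) ^ m" by (simp add: power_mult_distrib)
    also have "\<dots> \<le> (1 / 2) ^ m" using cQ Q by (intro power_mono) auto
    finally show ?thesis .
  qed
  have "norm (D m) \<le> real CARD('k) * real CARD('k) * (1 / 2) ^ m" for m
  proof -
    have "norm (D m) \<le> (\<Sum>i'\<in>UNIV. \<Sum>j'\<in>UNIV. norm (D m $ i' $ j'))"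
      unfolding norm_vec_def by (intro order.trans[OF L2_set_le_sum sum_mono] L2_set_le_sum) auto
    also have "\<dots> \<le> (\<Sum>i'\<in>(UNIV::'k set). \<Sum>j'\<in>(UNIV::'k set). (1 / 2) ^ m)"
      using entry_le by (intro sum_mono) auto
    finally show ?thesis by simp
  qed
  then have "summable D"
    by (intro summable_comparison_test[OF _ summable_mult[OF summable_geometric]]) auto
  then have "(\<lambda>m. D m $ i $ j) sums (suminf D $ i $ j)"
    by (intro bounded_linear.sums[OF bounded_linear_vec_nth] summable_sums)
  then show "(\<lambda>m. word_dev_coeff \<gamma> T w m i j * complex_of_real c ^ m) sums
      (development \<gamma> T (\<lambda>x. word_matrix w (c *\<^sub>R x)) $ i $ j)"
    unfolding development_def D_def dev_term_scaled_word_matrix .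
qed

end

lemma powser_coeff_eq_0_if_vanishing:
  fixes a :: "nat \<Rightarrow> 'a::{real_normed_field,banach}"
  assumes r: "0 < r"
    and vanish: "\<And>c. 0 < c \<Longrightarrow> c < r \<Longrightarrow> (\<lambda>m. a m * of_real c ^ m) sums 0"
    and below: "\<And>m. m < n \<Longrightarrow> a m = 0"
  shows "a n = 0"
proof -
  define b where "b m = a (m + n)" for m
  define f where "f x = (\<Sum>m. b m * x ^ m)" for x
  have b_sums_0: "(\<lambda>m. b m * of_real c ^ m) sums 0" if c: "0 < c" "c < r" for c
  proof -
    have "(\<lambda>m. a (m + n) * of_real c ^ (m + n)) sums 0"
      using sums_split_initial_segment[OF vanish[OF c], of n] below by simp
    then have "(\<lambda>m. inverse (of_real c ^ n) * (a (m + n) * of_real c ^ (m + n))) sums 0"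
      using sums_mult by fastforce
    then show ?thesis
      using c by (simp add: b_def power_add field_simps)
  qed
  have "isCont f 0"
    unfolding f_def
  proof (rule isCont_powser[where K = "of_real (r / 2)"])
    show "summable (\<lambda>m. b m * of_real (r / 2) ^ m)"
      using b_sums_0[of "r / 2"] r by (simp add: sums_iff)
  qed (use r in simp)
  then have "isCont (\<lambda>c::real. f (of_real c)) 0"
    using isCont_o2[where f = "of_real :: real \<Rightarrow> 'a" and a = 0 and g = f] by simp
  then have lim: "((\<lambda>c. f (of_real c)) \<longlongrightarrow> f 0) (at_right 0)"
    unfolding isCont_def by (auto intro: tendsto_mono[OF at_within_le_at])
  have vanishing: "eventually (\<lambda>c. f (of_real c) = 0) (at_right 0)"
    using eventually_at_right_real[OF r] by eventually_elim (use b_sums_0 in \<open>auto simp: f_def sums_iff\<close>)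
  have "((\<lambda>c::real. 0) \<longlongrightarrow> f 0) (at_right 0)"
    using lim by (simp add: tendsto_cong[OF vanishing])
  then have "f 0 = 0"
    by (simp add: tendsto_const_iff)
  then show ?thesis by (simp add: f_def b_def)
qed

lemma sig_coord_eq_if_word_developments_eq:
  fixes \<gamma>1 \<gamma>2 :: "real \<Rightarrow> real^'d"
  assumes paths: "p_var_path p T \<gamma>1" "p_var_path p T \<gamma>2"
    and w: "length w < CARD('k::{finite,linorder})"
    and equal: "\<And>c. development \<gamma>1 T (\<lambda>x. word_matrix w (c *\<^sub>R x) :: ((complex, 'k) vec, 'k) vec) =
                    development \<gamma>2 T (\<lambda>x. word_matrix w (c *\<^sub>R x))"
  shows "sig_coord \<gamma>1 T w = sig_coord \<gamma>2 T w"
proof -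
  interpret P1: p_var_path p T \<gamma>1 by (fact paths(1))
  interpret P2: p_var_path p T \<gamma>2 by (fact paths(2))
  obtain i0 j0 :: 'k where ij: "idx_pos i0 = 0" "idx_pos j0 = length w"
    using exists_idx_pos[of 0] exists_idx_pos[of "length w"] w by fastforce
  obtain r1 where r1: "0 < r1" "\<And>c. \<bar>c\<bar> < r1 \<Longrightarrow>
      (\<lambda>m. word_dev_coeff \<gamma>1 T w m i0 j0 * complex_of_real c ^ m) sums
        (development \<gamma>1 T (\<lambda>x. word_matrix w (c *\<^sub>R x)) $ i0 $ j0)"
    by (rule P1.development_scaled_word_matrix_sums[where w = w and i = i0 and j = j0])
      (rule that; assumption)
  obtain r2 where r2: "0 < r2" "\<And>c. \<bar>c\<bar> < r2 \<Longrightarrow>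
      (\<lambda>m. word_dev_coeff \<gamma>2 T w m i0 j0 * complex_of_real c ^ m) sums
        (development \<gamma>2 T (\<lambda>x. word_matrix w (c *\<^sub>R x)) $ i0 $ j0)"
    by (rule P2.development_scaled_word_matrix_sums[where w = w and i = i0 and j = j0])
      (rule that; assumption)
  define a where "a m = word_dev_coeff \<gamma>1 T w m i0 j0 - word_dev_coeff \<gamma>2 T w m i0 j0" for m
  have "a (length w) = 0"
  proof (rule powser_coeff_eq_0_if_vanishing[where r = "min r1 r2"])
    show "(\<lambda>m. a m * complex_of_real c ^ m) sums 0" if "0 < c" "c < min r1 r2" for c
      using sums_diff[OF r1(2)[of c] r2(2)[of c]] equal[of c] that
      unfolding a_def left_diff_distrib by simp
    show "a m = 0" if "m < length w" for m
      using word_dev_coeff_below[OF that ij] by (simp add: a_def)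
  qed (use r1 r2 in simp)
  then show ?thesis
    using word_dev_coeff_length[OF ij] by (simp add: a_def)
qed

theorem corollary5p1:
  fixes p T :: real and n :: nat
    and h :: "((complex, 'k::{finite,linorder}) vec, 'k) vec set"
    and \<gamma>1 \<gamma>2 :: "real \<Rightarrow> real^'d"
  assumes "1 \<le> p" and "p < 2"
    and "matrix_lie_algebra h" and "tk_real \<subseteq> h"
    and "0 < T"
    and "continuous_on {0..T} \<gamma>1" and "bounded_p_variation p \<gamma>1 0 T"
    and "continuous_on {0..T} \<gamma>2" and "bounded_p_variation p \<gamma>2 0 T"
    and "sig_level \<gamma>1 T n \<noteq> sig_level \<gamma>2 T n"
    and "CARD('k) \<ge> n + 1"
  shows "\<exists>M :: real^'d \<Rightarrow> ((complex, 'k) vec, 'k) vec. linear M \<and> range M \<subseteq> h \<and>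
           development \<gamma>1 T M \<noteq> development \<gamma>2 T M"
proof (rule ccontr)
  assume separating: "\<not> ?thesis"
  have paths: "p_var_path p T \<gamma>1" "p_var_path p T \<gamma>2"
    using assms by (auto intro: p_var_path.intro)
  obtain w where "sig_level \<gamma>1 T n w \<noteq> sig_level \<gamma>2 T n w"
    using assms(10) by (meson ext)
  then have w: "length w = n" "sig_coord \<gamma>1 T w \<noteq> sig_coord \<gamma>2 T w"
    by (auto simp: sig_level_def split: if_splits)
  have "development \<gamma>1 T (\<lambda>x. word_matrix w (c *\<^sub>R x) :: ((complex, 'k) vec, 'k) vec) =
      development \<gamma>2 T (\<lambda>x. word_matrix w (c *\<^sub>R x))" for c
  proof -
    define M where "M = (\<lambda>x. word_matrix w (c *\<^sub>R x) :: ((complex, 'k) vec, 'k) vec)"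
    have "linear M" "range M \<subseteq> h"
      unfolding M_def by (rule linear_scaled_word_matrix)
        (intro image_subsetI subsetD[OF assms(4)] word_matrix_in_tk_real)
    then show ?thesis using separating unfolding M_def by blast
  qed
  then have "sig_coord \<gamma>1 T w = sig_coord \<gamma>2 T w"
    using sig_coord_eq_if_word_developments_eq[OF paths, where 'k = 'k] w(1) assms(11) by simp
  with w show False by simp
qed

end
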